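(* Let $I\subset K[x_1,\ldots,x_n]$ be a graded prime ideal with $\dim I>0$. Then there exists a non-empty Zariski-open set $U\subset\mathrm{GL}_n(K)$ such that $T(g(I))$ is the same fan for all $g\in U$.
   Context: $K$ is an algebraically closed field of characteristic $0$ with trivial valuation; $\dim I$ denotes the Krull dimension of $K[x_1,\ldots,x_n]/I$. Each $g=(g_{ij})\in\mathrm{GL}_n(K)$ acts on $K[x_1,\ldots,x_n]$ by the automorphism $x_i\mapsto\sum_j g_{ij}x_j$; $\mathrm{GL}_n(K)$ has the Zariski topology. For $f=\sum_\nu a_\nu x^\nu$ and $\omega\in\mathbb{R}^n$, $\mathrm{in}_\omega(f)$ is the sum of the terms with $\omega\cdot\nu$ minimal, and $\mathrm{in}_\omega(I)$ is generated by all $\mathrm{in}_\omega(f)$, $f\in I$. The Gröbner fan $\mathrm{GF}(I)$ has as relatively open cones the classes of $\omega\sim\omega'\iff\mathrm{in}_\omega(I)=\mathrm{in}_{\omega'}(I)$. The tropical variety $T(I)=\{\omega:\mathrm{in}_\omega(f)\text{ is not a monomial for all }f\in I\}$ carries the fan structure of the subfan of $\mathrm{GF}(I)$ consisting of cones whose initial ideal contains no monomial. *)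

theory Defs
  imports "HOL-Analysis.Analysis" "HOL-Library.Poly_Mapping" "HOL-Library.Extended_Nat"
begin

type_synonym ('n, 'k) mpoly = "('n \<Rightarrow>\<^sub>0 nat) \<Rightarrow>\<^sub>0 'k"

definition alg_closed :: "'k::field itself \<Rightarrow> bool" where
  "alg_closed _ \<longleftrightarrow> (\<forall>p :: 'k poly. degree p > 0 \<longrightarrow> (\<exists>x. poly p x = 0))"

definition Var :: "'n \<Rightarrow> ('n, 'k::comm_ring_1) mpoly" where
  "Var i = Poly_Mapping.single (Poly_Mapping.single i 1) 1"

definition is_ideal :: "'a::comm_ring_1 set \<Rightarrow> bool" where
  "is_ideal I \<longleftrightarrow> 0 \<in> I \<and> (\<forall>a\<in>I. \<forall>b\<in>I. a + b \<in> I) \<and> (\<forall>r. \<forall>a\<in>I. r * a \<in> I)"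

definition ideal_gen :: "'a::comm_ring_1 set \<Rightarrow> 'a set" where
  "ideal_gen S = \<Inter> {J. is_ideal J \<and> S \<subseteq> J}"

definition is_prime_ideal :: "'a::comm_ring_1 set \<Rightarrow> bool" where
  "is_prime_ideal P \<longleftrightarrow> is_ideal P \<and> P \<noteq> UNIV \<and> (\<forall>a b. a * b \<in> P \<longrightarrow> a \<in> P \<or> b \<in> P)"

definition krull_dim :: "'a::comm_ring_1 set \<Rightarrow> enat" where
  "krull_dim I = Sup {enat m | m. \<exists>P :: nat \<Rightarrow> 'a set.
      (\<forall>i\<le>m. is_prime_ideal (P i)) \<and> I \<subseteq> P 0 \<and> (\<forall>i<m. P i \<subset> P (Suc i))}"

definition total_deg :: "('n::finite \<Rightarrow>\<^sub>0 nat) \<Rightarrow> nat" where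
  "total_deg \<nu> = (\<Sum>i\<in>UNIV. Poly_Mapping.lookup \<nu> i)"

definition hom_comp :: "nat \<Rightarrow> ('n::finite, 'k::comm_ring_1) mpoly \<Rightarrow> ('n, 'k) mpoly" where
  "hom_comp d f = (\<Sum>\<nu>\<in>{\<nu>\<in>Poly_Mapping.keys f. total_deg \<nu> = d}. Poly_Mapping.single \<nu> (Poly_Mapping.lookup f \<nu>))"

definition graded_ideal :: "('n::finite, 'k::comm_ring_1) mpoly set \<Rightarrow> bool" where
  "graded_ideal I \<longleftrightarrow> is_ideal I \<and> (\<forall>f\<in>I. \<forall>d. hom_comp d f \<in> I)"

definition lin_subst :: "'k^'n^'n \<Rightarrow> ('n::finite, 'k::comm_ring_1) mpoly \<Rightarrow> ('n, 'k) mpoly" where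
  "lin_subst g f = (\<Sum>\<nu>\<in>Poly_Mapping.keys f. Poly_Mapping.single 0 (Poly_Mapping.lookup f \<nu>) *
      (\<Prod>i\<in>UNIV. (\<Sum>j\<in>UNIV. Poly_Mapping.single 0 (g $ i $ j) * Var j) ^ Poly_Mapping.lookup \<nu> i))"

definition is_monomial :: "('n, 'k::zero) mpoly \<Rightarrow> bool" where
  "is_monomial p \<longleftrightarrow> (\<exists>\<nu> c. c \<noteq> 0 \<and> p = Poly_Mapping.single \<nu> c)"

definition wdeg :: "real^'n \<Rightarrow> ('n::finite \<Rightarrow>\<^sub>0 nat) \<Rightarrow> real" where
  "wdeg \<omega> \<nu> = (\<Sum>i\<in>UNIV. \<omega> $ i * real (Poly_Mapping.lookup \<nu> i))"

definition init_form :: "real^'n \<Rightarrow> ('n::finite, 'k::comm_ring_1) mpoly \<Rightarrow> ('n, 'k) mpoly" where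
  "init_form \<omega> f = (if f = 0 then 0 else
     (\<Sum>\<nu>\<in>{\<nu>\<in>Poly_Mapping.keys f. wdeg \<omega> \<nu> = Min (wdeg \<omega> ` Poly_Mapping.keys f)}. Poly_Mapping.single \<nu> (Poly_Mapping.lookup f \<nu>)))"

definition init_ideal :: "real^'n \<Rightarrow> ('n::finite, 'k::comm_ring_1) mpoly set \<Rightarrow> ('n, 'k) mpoly set" where
  "init_ideal \<omega> I = ideal_gen (init_form \<omega> ` I)"

text \<open>Relatively open cone of the Groebner fan containing \<omega>.\<close>
definition groebner_cone :: "('n::finite, 'k::comm_ring_1) mpoly set \<Rightarrow> real^'n \<Rightarrow> (real^'n) set" where
  "groebner_cone I \<omega> = {\<omega>'. init_ideal \<omega>' I = init_ideal \<omega> I}"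

text \<open>The tropical variety T(I) with its fan structure: the set of (relatively open)
  Groebner cones whose initial ideal contains no monomial.\<close>
definition trop_fan :: "('n::finite, 'k::comm_ring_1) mpoly set \<Rightarrow> (real^'n) set set" where
  "trop_fan I = {groebner_cone I \<omega> | \<omega>. \<not> (\<exists>m\<in>init_ideal \<omega> I. is_monomial m)}"

definition mpeval :: "('n \<times> 'n, 'k) mpoly \<Rightarrow> 'k^'n^'n \<Rightarrow> 'k::comm_ring_1" where
  "mpeval p g = (\<Sum>\<nu>\<in>Poly_Mapping.keys p. Poly_Mapping.lookup p \<nu> *
      (\<Prod>ij\<in>UNIV. (g $ fst ij $ snd ij) ^ Poly_Mapping.lookup \<nu> ij))"

definition zariski_open_GL :: "('k::comm_ring_1^'n::finite^'n) set \<Rightarrow> bool" where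
  "zariski_open_GL U \<longleftrightarrow> (\<exists>S :: ('n \<times> 'n, 'k) mpoly set.
      U = {g. invertible g \<and> (\<exists>p\<in>S. mpeval p g \<noteq> 0)})"

end

theory Submission
  imports Defs
begin

text \<open>For each degree \<open>d\<close>, the exponent sets that can serve as pivots of a row reduced basis of the
  degree \<open>d\<close> part of \<open>g(I)\<close> are the bases of a matroid, and this matroid is constant for \<open>g\<close> in a non-empty
  open set, since being a pivot set means that a minor does not vanish. The matroid decides when two
  weights give the same initial subspace in degree \<open>d\<close>, and which monomials this subspace contains.
  Finitely many degrees suffice: all \<open>in\<^sub>\<omega>(g(I))\<close> share the Hilbert function of \<open>I\<close>, and the monomial ideals
  with a given Hilbert function are generated in bounded degrees. Through leading monomials this bounds
  the degrees of generators of every graded ideal with this Hilbert function, and, with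
  an order of reverse lexicographic type, also the degree of a monomial of minimal degree in it.\<close>

subsection \<open>Pivot sets and leading exponents\<close>

text \<open>The initial ideals of g(I) move with g; what stays fixed is which weights give equal
  ones and which monomials occur. Hence initial ideals for different g are never compared: both
  questions are rewritten, for one g at a time, as conditions that see the ideal only through its
  pivot sets. This works because t can replace s in a pivot set exactly when t occurs in the reduced
  basis element with pivot s. So the matroid knows the supports of all reduced bases, and supports
  and weights decide which terms survive in an initial form. Every degree costs an open condition,
  and infinitely many could leave no common point. The degree bound must be uniform in g and
  \<omega>, so it is made to depend on the Hilbert function alone. Bounding generators does not yet
  control monomials, since an ideal generated in low degree may contain its first monomial later; a
  weight that counts a single variable repairs this. Weights may be negative, so no well-ordering is
  available; leading exponents are used degree by degree, where exponents are finite in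
  number.\<close>

definition cmul :: "'k::field \<Rightarrow> ('a::comm_monoid_add \<Rightarrow>\<^sub>0 'k) \<Rightarrow> ('a \<Rightarrow>\<^sub>0 'k)" where
  "cmul c f = Poly_Mapping.single 0 c * f"

lemma lookup_cmul [simp]: "Poly_Mapping.lookup (cmul c f) \<nu> = c * Poly_Mapping.lookup f \<nu>"
  unfolding cmul_def mult_map_scale_conv_mult[symmetric] by (simp add: Poly_Mapping.map.rep_eq when_def)

text \<open>Since \<open>cmul\<close> multiplies by a constant polynomial, ideals are subspaces at
  once; the interpretation provides \<open>span\<close>, \<open>independent\<close> and
  \<open>dim\<close>.\<close>

interpretation mp: vector_space cmul
  by unfold_locales (auto intro!: poly_mapping_eqI simp: lookup_add algebra_simps)

lemma lookup_sum_dual: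
  assumes "finite S" "t \<in> S"
    and "\<And>s. s \<in> S \<Longrightarrow> Poly_Mapping.lookup (b s) t = (if t = s then 1 else 0)"
  shows "Poly_Mapping.lookup (\<Sum>s\<in>S. cmul (c s) (b s)) t = c t"
proof -
  have "Poly_Mapping.lookup (\<Sum>s\<in>S. cmul (c s) (b s)) t = (\<Sum>s\<in>S. if s = t then c t else 0)"
    unfolding lookup_sum by (intro sum.cong) (auto simp: assms(3))
  then show ?thesis using assms by simp
qed

text \<open>Common shape of \<open>hom_comp\<close> and, on nonzero arguments, of
  \<open>init_form\<close>.\<close>

definition fpart :: "('a \<Rightarrow> bool) \<Rightarrow> ('a \<Rightarrow>\<^sub>0 'k) \<Rightarrow> ('a \<Rightarrow>\<^sub>0 'k::comm_monoid_add)" where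
  "fpart P f = (\<Sum>\<nu>\<in>{\<nu>\<in>Poly_Mapping.keys f. P \<nu>}. Poly_Mapping.single \<nu> (Poly_Mapping.lookup f \<nu>))"

lemma lookup_fpart [simp]:
  "Poly_Mapping.lookup (fpart P f) \<nu> = (if P \<nu> then Poly_Mapping.lookup f \<nu> else 0)"
proof -
  have "Poly_Mapping.lookup (fpart P f) \<nu> =
      (\<Sum>\<mu>\<in>{\<mu>\<in>Poly_Mapping.keys f. P \<mu>}. if \<mu> = \<nu> then Poly_Mapping.lookup f \<mu> else 0)"
    unfolding fpart_def lookup_sum
    by (intro sum.cong) (auto simp: lookup_single when_def)
  then show ?thesis by (auto simp: in_keys_iff)
qed

text \<open>\<open>S\<close> is a basis of the matroid of the coordinate functions on \<open>V\<close>. Then \<open>dual V S\<close>, defined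
  below, enumerates the row reduced basis of \<open>V\<close> with pivots \<open>S\<close>; otherwise it is junk.\<close>
definition piv :: "('a \<Rightarrow>\<^sub>0 'k::field) set \<Rightarrow> 'a set \<Rightarrow> bool" where
  "piv V S \<longleftrightarrow> finite S \<and> (\<forall>f\<in>V. (\<forall>s\<in>S. Poly_Mapping.lookup f s = 0) \<longrightarrow> f = 0) \<and>
     (\<forall>s\<in>S. \<exists>f\<in>V. \<forall>t\<in>S. Poly_Mapping.lookup f t = (if t = s then 1 else 0))"

definition dual :: "('a \<Rightarrow>\<^sub>0 'k::field) set \<Rightarrow> 'a set \<Rightarrow> 'a \<Rightarrow> ('a \<Rightarrow>\<^sub>0 'k)" where
  "dual V S s = (SOME f. f \<in> V \<and> (\<forall>t\<in>S. Poly_Mapping.lookup f t = (if t = s then 1 else 0)))"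

lemma pivD0: "piv V S \<Longrightarrow> f \<in> V \<Longrightarrow> (\<And>s. s \<in> S \<Longrightarrow> Poly_Mapping.lookup f s = 0) \<Longrightarrow> f = 0"
  unfolding piv_def by blast

lemma piv_finite: "piv V S \<Longrightarrow> finite S"
  unfolding piv_def by blast

lemma dual:
  assumes "piv V S" "s \<in> S"
  shows dual_in: "dual V S s \<in> V"
    and lookup_dual: "t \<in> S \<Longrightarrow> Poly_Mapping.lookup (dual V S s) t = (if t = s then 1 else 0)"
proof -
  have "\<exists>f. f \<in> V \<and> (\<forall>t\<in>S. Poly_Mapping.lookup f t = (if t = s then 1 else 0))"
    using assms unfolding piv_def by blast
  from someI_ex[OF this] show "dual V S s \<in> V"
    "t \<in> S \<Longrightarrow> Poly_Mapping.lookup (dual V S s) t = (if t = s then 1 else 0)"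
    unfolding dual_def by blast+
qed

lemma piv_eqI:
  assumes "mp.subspace V" "piv V S" "f \<in> V" "g \<in> V"
    and "\<And>s. s \<in> S \<Longrightarrow> Poly_Mapping.lookup f s = Poly_Mapping.lookup g s"
  shows "f = g"
proof -
  have "f - g \<in> V" using assms(1,3,4) by (rule mp.subspace_diff)
  then have "f - g = 0" by (rule pivD0[OF assms(2)]) (simp add: assms(5) lookup_minus)
  then show ?thesis by simp
qed

lemma dual_eqI:
  assumes "mp.subspace V" "piv V S" "s \<in> S" "f \<in> V"
    and "\<And>t. t \<in> S \<Longrightarrow> Poly_Mapping.lookup f t = (if t = s then 1 else 0)"
  shows "f = dual V S s"
  by (rule piv_eqI[OF assms(1,2,4)]) (use assms in \<open>simp_all add: dual_in lookup_dual\<close>)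

lemma dual_expansion:
  assumes "mp.subspace V" "piv V S" "f \<in> V"
  shows "f = (\<Sum>s\<in>S. cmul (Poly_Mapping.lookup f s) (dual V S s))"
proof (rule piv_eqI[OF assms])
  show "(\<Sum>s\<in>S. cmul (Poly_Mapping.lookup f s) (dual V S s)) \<in> V"
    using assms by (intro mp.subspace_sum mp.subspace_scale) (auto simp: dual_in)
  fix t assume t: "t \<in> S"
  then show "Poly_Mapping.lookup f t =
      Poly_Mapping.lookup (\<Sum>s\<in>S. cmul (Poly_Mapping.lookup f s) (dual V S s)) t"
    using assms(2) by (subst lookup_sum_dual) (auto simp: lookup_dual piv_finite)
qed

lemma independent_of_dual:
  assumes "finite S" and b: "\<And>s t. s \<in> S \<Longrightarrow> t \<in> S \<Longrightarrow> Poly_Mapping.lookup (b s) t = (if t = s then 1 else (0::'k::field))"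
  shows "mp.independent (b ` S)" and "inj_on b S"
proof -
  show inj: "inj_on b S"
  proof (rule inj_onI)
    fix s t assume "s \<in> S" "t \<in> S" "b s = b t"
    then have "Poly_Mapping.lookup (b s) t = 1" using b[of t t] by simp
    then show "s = t" using b[of s t] \<open>s \<in> S\<close> \<open>t \<in> S\<close> by (auto split: if_splits)
  qed
  show "mp.independent (b ` S)"
  proof (rule mp.independent_if_scalars_zero)
    show "finite (b ` S)" using assms by simp
    fix c x assume sum0: "(\<Sum>x\<in>b ` S. cmul (c x) x) = 0" and x: "x \<in> b ` S"
    then obtain t where t: "t \<in> S" "x = b t" by auto
    have "0 = Poly_Mapping.lookup (\<Sum>s\<in>S. cmul (c (b s)) (b s)) t"
      using sum0 by (simp add: sum.reindex[OF inj])
    also have "\<dots> = c (b t)" by (intro lookup_sum_dual assms t b)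
    finally show "c x = 0" using t by simp
  qed
qed

lemma piv_dim:
  assumes "mp.subspace V" "piv V S"
  shows "mp.dim V = card S"
proof -
  note b = independent_of_dual[of S "dual V S", OF piv_finite[OF assms(2)] lookup_dual[OF assms(2)]]
  have "V \<subseteq> mp.span (dual V S ` S)"
  proof
    fix f assume "f \<in> V"
    then have "f = (\<Sum>s\<in>S. cmul (Poly_Mapping.lookup f s) (dual V S s))"
      using dual_expansion assms by blast
    also have "\<dots> \<in> mp.span (dual V S ` S)"
      by (intro mp.span_sum mp.span_scale mp.span_base) auto
    finally show "f \<in> mp.span (dual V S ` S)" .
  qed
  moreover have "dual V S ` S \<subseteq> V" using assms by (auto simp: dual_in)
  ultimately have "card (dual V S ` S) = mp.dim V" using b by (intro mp.basis_card_eq_dim) auto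
  then show ?thesis using b(2) by (simp add: card_image)
qed

text \<open>Dual vectors for \<open>S\<close> are independent, and being as many as the dimension
  they span \<open>V\<close>; the coefficients of \<open>f\<close> in them are its values on
  \<open>S\<close>. So exhibiting dual vectors suffices. \<open>S0\<close> certifies that
  \<open>V\<close> has finite dimension.\<close>

lemma piv_of_dim:
  assumes V: "mp.subspace V" and S0: "piv V S0" and S: "finite S" "card S = mp.dim V"
    and "\<And>s. s \<in> S \<Longrightarrow> \<exists>f\<in>V. \<forall>t\<in>S. Poly_Mapping.lookup f t = (if t = s then 1 else 0)"
  shows "piv V S"
  unfolding piv_def
proof (intro conjI ballI impI)
  obtain b where b: "\<And>s. s \<in> S \<Longrightarrow> b s \<in> V"
    "\<And>s t. s \<in> S \<Longrightarrow> t \<in> S \<Longrightarrow> Poly_Mapping.lookup (b s) t = (if t = s then 1 else 0)"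
    using assms(5) by metis
  note ind = independent_of_dual[of S b, OF S(1) b(2)]
  let ?B = "dual V S0 ` S0"
  have span: "V \<subseteq> mp.span ?B"
  proof
    fix f assume "f \<in> V"
    then have "f = (\<Sum>s\<in>S0. cmul (Poly_Mapping.lookup f s) (dual V S0 s))"
      using dual_expansion V S0 by blast
    also have "\<dots> \<in> mp.span ?B"
      by (intro mp.span_sum mp.span_scale mp.span_base) auto
    finally show "f \<in> mp.span ?B" .
  qed
  fix f assume f: "f \<in> V" "\<forall>s\<in>S. Poly_Mapping.lookup f s = 0"
  have "f \<in> mp.span (b ` S)"
  proof (rule ccontr)
    assume nf: "f \<notin> mp.span (b ` S)"
    then have "mp.independent (insert f (b ` S))" using ind by (intro mp.independent_insertI) auto
    moreover have "insert f (b ` S) \<subseteq> mp.span ?B" using f b span by auto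
    ultimately have "card (insert f (b ` S)) \<le> card ?B"
      using mp.independent_span_bound piv_finite[OF S0] by blast
    moreover have "f \<notin> b ` S" using nf mp.span_base by blast
    ultimately have "Suc (card S) \<le> card S0"
      using ind(2) S(1) card_image_le[OF piv_finite[OF S0], of "dual V S0"] by (auto simp: card_image)
    then show False using piv_dim[OF V S0] S(2) by simp
  qed
  then obtain c where c: "f = (\<Sum>x\<in>b ` S. cmul (c x) x)"
    using mp.span_finite[of "b ` S"] S(1) by auto
  have "c (b t) = 0" if t: "t \<in> S" for t
  proof -
    have "0 = Poly_Mapping.lookup f t" using f t by simp
    also have "\<dots> = Poly_Mapping.lookup (\<Sum>s\<in>S. cmul (c (b s)) (b s)) t"
      unfolding c by (simp add: sum.reindex[OF ind(2)])
    also have "\<dots> = c (b t)" by (intro lookup_sum_dual S t b)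
    finally show ?thesis by simp
  qed
  then show "f = 0" unfolding c by (auto intro!: sum.neutral)
qed (use assms in auto)

text \<open>By the count, \<open>S\<close> is a pivot set of \<open>W\<close> as well, so an element
  of \<open>W\<close> equals its expansion in the reduced basis of \<open>V\<close>, with which it
  agrees on \<open>S\<close>.\<close>

lemma piv_subset_eq:
  assumes "mp.subspace V" "mp.subspace W" "V \<subseteq> W" "piv V S" "piv W T" "card S = card T"
  shows "V = W"
proof -
  have "piv W S"
  proof (rule piv_of_dim[OF assms(2,5) piv_finite[OF assms(4)]])
    show "card S = mp.dim W" using piv_dim[OF assms(2,5)] assms(6) by simp
    fix s assume "s \<in> S"
    then show "\<exists>f\<in>W. \<forall>t\<in>S. Poly_Mapping.lookup f t = (if t = s then 1 else 0)"
      using assms(3,4) unfolding piv_def by fast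
  qed
  have "f \<in> V" if f: "f \<in> W" for f
  proof -
    have "f = (\<Sum>s\<in>S. cmul (Poly_Mapping.lookup f s) (dual V S s))"
    proof (rule piv_eqI[OF assms(2) \<open>piv W S\<close> f])
      show "(\<Sum>s\<in>S. cmul (Poly_Mapping.lookup f s) (dual V S s)) \<in> W"
        using assms by (intro mp.subspace_sum mp.subspace_scale) (auto simp: dual_in)
      fix t assume t: "t \<in> S"
      then show "Poly_Mapping.lookup f t =
          Poly_Mapping.lookup (\<Sum>s\<in>S. cmul (Poly_Mapping.lookup f s) (dual V S s)) t"
        using assms(4) by (subst lookup_sum_dual) (auto simp: lookup_dual piv_finite)
    qed
    also have "\<dots> \<in> V" using assms by (intro mp.subspace_sum mp.subspace_scale) (auto simp: dual_in)
    finally show ?thesis .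
  qed
  then show ?thesis using assms(3) by blast
qed

text \<open>The pivot step of Gaussian elimination. It makes the supports of the reduced basis,
  though not the coefficients, an invariant of the matroid.\<close>

lemma piv_exchange:
  assumes V: "mp.subspace V" and S: "piv V S" and s: "s \<in> S" and t: "t \<notin> S"
  shows "piv V (insert t (S - {s})) \<longleftrightarrow> Poly_Mapping.lookup (dual V S s) t \<noteq> 0"
proof
  assume P: "piv V (insert t (S - {s}))"
  show "Poly_Mapping.lookup (dual V S s) t \<noteq> 0"
  proof
    assume "Poly_Mapping.lookup (dual V S s) t = 0"
    then have "dual V S s = 0"
      by (intro pivD0[OF P]) (auto simp: dual_in lookup_dual S s)
    then show False using lookup_dual[OF S s s] by simp
  qed
next
  let ?d = "dual V S" and ?l = Poly_Mapping.lookup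
  assume nz: "?l (?d s) t \<noteq> 0"
  show "piv V (insert t (S - {s}))"
    unfolding piv_def
  proof (intro conjI ballI impI)
    show "finite (insert t (S - {s}))" using piv_finite[OF S] by simp
  next
    fix f assume f: "f \<in> V" "\<forall>u\<in>insert t (S - {s}). ?l f u = 0"
    have "f = cmul (?l f s) (?d s)"
      by (rule piv_eqI[OF V S f(1)]) (use f s S V in \<open>auto simp: lookup_dual dual_in mp.subspace_scale\<close>)
    then have "?l f t = ?l f s * ?l (?d s) t" by (metis lookup_cmul)
    then have "?l f s = 0" using f nz by simp
    then show "f = 0" using f by (intro pivD0[OF S f(1)]) auto
  next
    fix u assume u: "u \<in> insert t (S - {s})"
    show "\<exists>f\<in>V. \<forall>v\<in>insert t (S - {s}). ?l f v = (if v = u then 1 else 0)"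
    proof (cases "u = t")
      case True
      have "cmul (inverse (?l (?d s) t)) (?d s) \<in> V" by (simp add: V S s dual_in mp.subspace_scale)
      moreover have "?l (cmul (inverse (?l (?d s) t)) (?d s)) v = (if v = u then 1 else 0)"
        if "v \<in> insert t (S - {s})" for v
        using that True nz S s t by (auto simp: lookup_dual)
      ultimately show ?thesis by blast
    next
      case False
      let ?f = "?d u - cmul (?l (?d u) t / ?l (?d s) t) (?d s)"
      have u: "u \<in> S" "u \<noteq> s" using u False by auto
      have "?f \<in> V" by (simp add: V S s u dual_in mp.subspace_scale mp.subspace_diff)
      moreover have "?l ?f v = (if v = u then 1 else 0)"
        if "v \<in> insert t (S - {s})" for v
        using that False nz S s t u by (auto simp: lookup_dual lookup_minus)
      ultimately show ?thesis by blast
    qed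
  qed
qed

section \<open>Leading exponents for a strict total order\<close>

locale term_order =
  fixes lt :: "'a::comm_monoid_add \<Rightarrow> 'a \<Rightarrow> bool"
  assumes irrefl: "\<not> lt a a"
    and trans: "lt a b \<Longrightarrow> lt b c \<Longrightarrow> lt a c"
    and total: "a \<noteq> b \<Longrightarrow> lt a b \<or> lt b a"
begin

text \<open>Minimal exponents lead, in accordance with \<open>init_form\<close>. Finiteness of
  supports takes the place of well-foundedness of \<open>lt\<close>.\<close>

definition is_lead :: "('a \<Rightarrow>\<^sub>0 'k::zero) \<Rightarrow> 'a \<Rightarrow> bool" where
  "is_lead f \<nu> \<longleftrightarrow> Poly_Mapping.lookup f \<nu> \<noteq> 0 \<and> (\<forall>\<mu>. Poly_Mapping.lookup f \<mu> \<noteq> 0 \<longrightarrow> \<not> lt \<mu> \<nu>)"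

definition leads :: "('a \<Rightarrow>\<^sub>0 'k::zero) set \<Rightarrow> 'a set" where
  "leads V = {\<nu>. \<exists>f\<in>V. is_lead f \<nu>}"

lemma asym: "lt a b \<Longrightarrow> \<not> lt b a"
  using irrefl trans by blast

lemma finite_least:
  assumes "finite A" "A \<noteq> {}"
  shows "\<exists>m\<in>A. \<forall>x\<in>A. \<not> lt x m"
proof -
  have "\<exists>m\<in>A. \<forall>x\<in>A. x \<noteq> m \<longrightarrow> \<not> lt x m"
    using assms by (intro Finite_Set.bex_min_element asymp_onI transp_onI) (auto dest: asym trans)
  then show ?thesis using irrefl by metis
qed

lemma finite_greatest:
  assumes "finite A" "A \<noteq> {}"
  shows "\<exists>m\<in>A. \<forall>x\<in>A. \<not> lt m x"
proof -
  have "\<exists>m\<in>A. \<forall>x\<in>A. x \<noteq> m \<longrightarrow> \<not> lt m x"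
    using assms by (intro Finite_Set.bex_max_element asymp_onI transp_onI) (auto dest: asym trans)
  then show ?thesis using irrefl by metis
qed

lemma lead_exists: "f \<noteq> 0 \<Longrightarrow> \<exists>\<nu>. is_lead f \<nu>"
  using finite_least[of "Poly_Mapping.keys f"] unfolding is_lead_def by (auto simp: in_keys_iff)

text \<open>A triangular system, solved by induction on \<open>T\<close>: an element led by the
  greatest exponent of \<open>T\<close> vanishes at all others in \<open>T\<close>, so adding a
  multiple of it corrects the value there and disturbs no value already prescribed.\<close>

lemma leads_surj:
  fixes V :: "('a \<Rightarrow>\<^sub>0 'k::field) set"
  assumes V: "mp.subspace V" and "finite T" "T \<subseteq> leads V"
  shows "\<exists>f\<in>V. \<forall>t\<in>T. Poly_Mapping.lookup f t = c t"
  using assms(2,3)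
proof (induct "card T" arbitrary: T)
  case 0
  then show ?case using mp.subspace_0[OF V] by auto
next
  case (Suc n T)
  then have "T \<noteq> {}" by auto
  then obtain m where m: "m \<in> T" "\<forall>x\<in>T. \<not> lt m x"
    using finite_greatest[OF Suc.prems(1)] by blast
  then obtain p where p: "p \<in> V" "is_lead p m" using Suc.prems(2) unfolding leads_def by blast
  have "T - {m} \<subseteq> leads V" "n = card (T - {m})" "finite (T - {m})"
    using Suc.hyps(2) Suc.prems m(1) by auto
  then obtain f where f: "f \<in> V" "\<forall>t\<in>T - {m}. Poly_Mapping.lookup f t = c t"
    using Suc.hyps(1)[of "T - {m}"] by blast
  let ?f = "f + cmul ((c m - Poly_Mapping.lookup f m) / Poly_Mapping.lookup p m) p"
  have "?f \<in> V" using f p V by (simp add: mp.subspace_add mp.subspace_scale)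
  moreover have "Poly_Mapping.lookup ?f t = c t" if "t \<in> T" for t
  proof (cases "t = m")
    case True
    then show ?thesis using p by (simp add: lookup_add is_lead_def)
  next
    case False
    then have "lt t m" using total m that by blast
    then have "Poly_Mapping.lookup p t = 0" using p unfolding is_lead_def by blast
    then show ?thesis using f False that by (simp add: lookup_add)
  qed
  ultimately show ?case by blast
qed

text \<open>A nonzero element of \<open>V\<close> does not vanish at its own leading exponent; dual
  vectors come from \<open>leads_surj\<close>.\<close>

lemma piv_leads:
  fixes V :: "('a \<Rightarrow>\<^sub>0 'k::field) set"
  assumes V: "mp.subspace V" and "finite (leads V)"
  shows "piv V (leads V)"
  unfolding piv_def
proof (intro conjI ballI impI)
  fix f assume f: "f \<in> V" "\<forall>s\<in>leads V. Poly_Mapping.lookup f s = 0"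
  show "f = 0"
  proof (rule ccontr)
    assume "f \<noteq> 0"
    then obtain \<nu> where "is_lead f \<nu>" using lead_exists by blast
    then show False using f unfolding leads_def is_lead_def by blast
  qed
next
  fix s show "\<exists>f\<in>V. \<forall>t\<in>leads V. Poly_Mapping.lookup f t = (if t = s then 1 else 0)"
    using leads_surj[OF V assms(2)] by simp
qed fact

text \<open>The leading exponent of \<open>dual V (leads V) s\<close> belongs to
  \<open>leads V\<close>, and there this element is nonzero only at \<open>s\<close>.\<close>

lemma is_lead_dual:
  fixes V :: "('a \<Rightarrow>\<^sub>0 'k::field) set"
  assumes V: "mp.subspace V" and "finite (leads V)" and s: "s \<in> leads V"
  shows "is_lead (dual V (leads V) s) s"
proof -
  note P = piv_leads[OF assms(1,2)]
  have nz: "dual V (leads V) s \<noteq> 0" using lookup_dual[OF P s s] by auto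
  then obtain \<nu> where \<nu>: "is_lead (dual V (leads V) s) \<nu>" using lead_exists by blast
  then have "\<nu> \<in> leads V" using dual_in[OF P s] unfolding leads_def by blast
  then have "\<nu> = s" using \<nu> lookup_dual[OF P s] unfolding is_lead_def by (metis (full_types))
  then show ?thesis using \<nu> by simp
qed

end

subsection \<open>Monomial ideals with a given Hilbert function\<close>

text \<open>Treat one coordinate at a time. A monotone subsequence of naturals is increasing, or it
  decreases and is constant from some index \<open>k\<close> on; dropping the terms before
  \<open>k\<close> gives a weakly increasing sequence in both cases.\<close>

lemma subsequence_mono:
  fixes s :: "nat \<Rightarrow> 'a \<Rightarrow> nat"
  assumes "finite A"
  shows "\<exists>\<phi> :: nat \<Rightarrow> nat. strict_mono \<phi> \<and> (\<forall>x\<in>A. \<forall>i j. i \<le> j \<longrightarrow> s (\<phi> i) x \<le> s (\<phi> j) x)"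
  using assms
proof (induction A rule: finite_induct)
  case empty
  then show ?case by (intro exI[of _ id]) (simp add: strict_mono_def)
next
  case (insert x A)
  then obtain \<phi> :: "nat \<Rightarrow> nat" where \<phi>: "strict_mono \<phi>" "\<And>y i j. y \<in> A \<Longrightarrow> i \<le> j \<Longrightarrow> s (\<phi> i) y \<le> s (\<phi> j) y"
    by blast
  obtain \<psi> :: "nat \<Rightarrow> nat" where \<psi>: "strict_mono \<psi>" "monoseq (\<lambda>n. s (\<phi> (\<psi> n)) x)"
    using seq_monosub[of "\<lambda>n. s (\<phi> n) x"] by auto
  have "\<exists>k. \<forall>i j. k \<le> i \<longrightarrow> i \<le> j \<longrightarrow> s (\<phi> (\<psi> i)) x \<le> s (\<phi> (\<psi> j)) x"
  proof (cases "incseq (\<lambda>n. s (\<phi> (\<psi> n)) x)")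
    case True
    then show ?thesis by (auto simp: incseq_def)
  next
    case False
    then have dec: "\<And>i j. i \<le> j \<Longrightarrow> s (\<phi> (\<psi> j)) x \<le> s (\<phi> (\<psi> i)) x"
      using \<psi>(2) by (auto simp: monoseq_iff decseq_def)
    obtain k where k: "\<And>i. s (\<phi> (\<psi> k)) x \<le> s (\<phi> (\<psi> i)) x"
      using ex_has_least_nat[of "\<lambda>_. True" 0 "\<lambda>n. s (\<phi> (\<psi> n)) x"] by auto
    have "s (\<phi> (\<psi> i)) x \<le> s (\<phi> (\<psi> j)) x" if "k \<le> i" "i \<le> j" for i j
      using dec[OF that(1)] k[of j] by (rule le_trans)
    then show ?thesis by blast
  qed
  then obtain k where k: "\<And>i j. k \<le> i \<Longrightarrow> i \<le> j \<Longrightarrow> s (\<phi> (\<psi> i)) x \<le> s (\<phi> (\<psi> j)) x" by blast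
  let ?\<chi> = "\<lambda>i. \<phi> (\<psi> (k + i))"
  have "strict_mono ?\<chi>" using \<phi>(1) \<psi>(1) by (simp add: strict_mono_def)
  moreover have "s (?\<chi> i) y \<le> s (?\<chi> j) y" if "y \<in> insert x A" "i \<le> j" for y i j
  proof (cases "y = x")
    case True
    then show ?thesis using k that by simp
  next
    case False
    then show ?thesis using \<phi>(2)[of y] that strict_mono_leD[OF \<psi>(1)] by simp
  qed
  ultimately show ?case by (intro exI[of _ ?\<chi>]) simp
qed

lemma dickson:
  fixes s :: "nat \<Rightarrow> ('n::finite \<Rightarrow>\<^sub>0 nat)"
  shows "\<exists>i j \<rho>. i < j \<and> s j = s i + \<rho>"
proof -
  obtain \<phi> :: "nat \<Rightarrow> nat" where \<phi>: "strict_mono \<phi>"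
    "\<And>x i j. i \<le> j \<Longrightarrow> Poly_Mapping.lookup (s (\<phi> i)) x \<le> Poly_Mapping.lookup (s (\<phi> j)) x"
    using subsequence_mono[of "UNIV :: 'n set" "\<lambda>n. Poly_Mapping.lookup (s n)"] by auto
  have "s (\<phi> 1) = s (\<phi> 0) + (s (\<phi> 1) - s (\<phi> 0))"
    by (rule poly_mapping_eqI) (simp add: lookup_add lookup_minus \<phi>(2))
  moreover have "\<phi> 0 < \<phi> 1" using \<phi>(1) by (simp add: strict_mono_def)
  ultimately show ?thesis by blast
qed

section \<open>Exponents of a fixed degree and degree bounds for upsets\<close>

lemma total_deg_add [simp]: "total_deg (\<nu> + \<mu>) = total_deg \<nu> + total_deg \<mu>"
  by (simp add: total_deg_def lookup_add sum.distrib)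

definition mons :: "nat \<Rightarrow> ('n::finite \<Rightarrow>\<^sub>0 nat) set" where
  "mons d = {\<nu>. total_deg \<nu> = d}"

lemma finite_mons [simp]: "finite (mons d :: ('n::finite \<Rightarrow>\<^sub>0 nat) set)"
proof -
  have "Poly_Mapping.lookup ` (mons d :: ('n \<Rightarrow>\<^sub>0 nat) set) \<subseteq> PiE UNIV (\<lambda>_. {..d})"
    by (auto simp: mons_def total_deg_def intro: member_le_sum)
  then have "finite (Poly_Mapping.lookup ` (mons d :: ('n \<Rightarrow>\<^sub>0 nat) set))"
    by (rule finite_subset) (simp add: finite_PiE)
  then show ?thesis by (rule finite_imageD) (auto intro!: inj_onI poly_mapping_eqI)
qed

text \<open>The exponent sets of monomial ideals.\<close>

definition upset :: "'a::monoid_add set \<Rightarrow> bool" where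
  "upset N \<longleftrightarrow> (\<forall>\<nu>\<in>N. \<forall>\<mu>. \<nu> + \<mu> \<in> N)"

text \<open>For an upset: the monomial ideal is generated in degrees at most
  \<open>D\<close>.\<close>

definition gen_upto :: "nat \<Rightarrow> ('n::finite \<Rightarrow>\<^sub>0 nat) set \<Rightarrow> bool" where
  "gen_upto D N \<longleftrightarrow> (\<forall>\<nu>\<in>N. \<exists>\<mu>\<in>N. \<exists>\<rho>. \<nu> = \<mu> + \<rho> \<and> total_deg \<mu> \<le> D)"

lemma gen_upto_mono: "gen_upto D N \<Longrightarrow> D \<le> E \<Longrightarrow> gen_upto E N"
  unfolding gen_upto_def by (meson le_trans)

text \<open>Macaulay: otherwise one builds, by pigeonhole in a degree where the upset generated so far
  is too small, a sequence of monomials contradicting Dickson's lemma.\<close>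
lemma gen_upto_of_hilbert_function:
  fixes r :: "nat \<Rightarrow> nat"
  shows "\<exists>D. \<forall>N :: ('n::finite \<Rightarrow>\<^sub>0 nat) set. upset N \<longrightarrow> (\<forall>d. card (N \<inter> mons d) = r d) \<longrightarrow> gen_upto D N"
proof (rule ccontr)
  define Fam where "Fam F = {N :: ('n \<Rightarrow>\<^sub>0 nat) set. upset N \<and> (\<forall>d. card (N \<inter> mons d) = r d) \<and> F \<subseteq> N}" for F
  define up where "up F = {\<mu> + \<rho> | \<mu> \<rho>. \<mu> \<in> F}" for F :: "('n \<Rightarrow>\<^sub>0 nat) set"
  \<comment> \<open>The invariant of the construction: the generators collected in \<open>F\<close>
    still leave the generating degrees unbounded.\<close>
  define bad where "bad F \<longleftrightarrow> finite F \<and> (\<forall>D. \<exists>N\<in>Fam F. \<not> gen_upto D N)" for F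
  assume "\<not> ?thesis"
  then have bad0: "bad {}" by (auto simp: bad_def Fam_def)
  have up_sub: "up F \<subseteq> N" if "N \<in> Fam F" for N F
  proof
    fix \<nu> assume "\<nu> \<in> up F"
    then obtain \<mu> \<rho> where "\<nu> = \<mu> + \<rho>" "\<mu> \<in> F" unfolding up_def by blast
    moreover have "upset N" "F \<subseteq> N" using that by (simp_all add: Fam_def)
    ultimately show "\<nu> \<in> N" unfolding upset_def by auto
  qed
  have "\<exists>m. m \<notin> up F \<and> bad (insert m F)" if bad: "bad F" for F
  proof -
    have fin: "finite F" using bad by (simp add: bad_def)
    have "\<exists>d. card (up F \<inter> mons d) \<noteq> r d"
    \<comment> \<open>If \<open>up F\<close> already had Hilbert function \<open>r\<close>, it would
      be the only member of \<open>Fam F\<close>, and the sum of the degrees in \<open>F\<close>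
      would be a bound, contrary to \<open>bad F\<close>.\<close>
    proof (rule ccontr)
      assume eq: "\<nexists>d. card (up F \<inter> mons d) \<noteq> r d"
      obtain N where N: "N \<in> Fam F" "\<not> gen_upto (\<Sum>\<mu>\<in>F. total_deg \<mu>) N"
        using bad unfolding bad_def by blast
      have eqd: "up F \<inter> mons d = N \<inter> mons d" for d
        by (rule card_subset_eq) (use up_sub[OF N(1)] N(1) eq in \<open>auto simp: Fam_def\<close>)
      have "\<nu> \<in> N \<longleftrightarrow> \<nu> \<in> up F" for \<nu>
      proof -
        have "\<nu> \<in> up F \<inter> mons (total_deg \<nu>) \<longleftrightarrow> \<nu> \<in> N \<inter> mons (total_deg \<nu>)" using eqd by simp
        then show ?thesis by (simp add: mons_def)
      qed
      then have "N = up F" by (rule set_eqI)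
      moreover have "gen_upto (\<Sum>\<mu>\<in>F. total_deg \<mu>) (up F)"
        unfolding gen_upto_def
      proof
        fix \<nu> assume "\<nu> \<in> up F"
        then obtain \<mu> \<rho> where *: "\<nu> = \<mu> + \<rho>" "\<mu> \<in> F" by (auto simp: up_def)
        have "\<mu> = \<mu> + 0" by simp
        then have "\<mu> \<in> up F" using *(2) unfolding up_def by blast
        moreover have "total_deg \<mu> \<le> (\<Sum>\<mu>\<in>F. total_deg \<mu>)"
          using *(2) fin by (intro member_le_sum) auto
        ultimately show "\<exists>\<mu>\<in>up F. \<exists>\<rho>. \<nu> = \<mu> + \<rho> \<and> total_deg \<mu> \<le> (\<Sum>\<mu>\<in>F. total_deg \<mu>)"
          using * by blast
      qed
      ultimately show False using N by simp
    qed
    then obtain d where d: "card (up F \<inter> mons d) \<noteq> r d" by blast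
    show ?thesis
    proof (rule ccontr)
      assume "\<not> ?thesis"
      then have "\<exists>D. m \<notin> up F \<longrightarrow> (\<forall>N\<in>Fam (insert m F). gen_upto D N)" for m
        using fin unfolding bad_def by (cases "m \<in> up F") (simp, blast)
      then obtain B where B: "\<And>m. m \<notin> up F \<longrightarrow> (\<forall>N\<in>Fam (insert m F). gen_upto (B m) N)"
        by metis
      \<comment> \<open>Degree \<open>d\<close> has finitely many monomials, so this sum dominates
        each \<open>B m\<close>. Since \<open>up F\<close> has the wrong count in degree
        \<open>d\<close>, the set \<open>N\<close> contains some \<open>m\<close> of that degree
        outside \<open>up F\<close> and is therefore bounded by \<open>B m\<close>.\<close>
      obtain N where N: "N \<in> Fam F" "\<not> gen_upto (\<Sum>m\<in>mons d. B m) N"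
        using bad unfolding bad_def by blast
      have "card (N \<inter> mons d) = r d" "F \<subseteq> N" "upset N" using N(1) by (simp_all add: Fam_def)
      then have "up F \<inter> mons d \<noteq> N \<inter> mons d" using d by metis
      then obtain m where m: "m \<in> N" "m \<in> mons d" "m \<notin> up F" using up_sub[OF N(1)] by blast
      have "N \<in> Fam (insert m F)" using N(1) m(1) by (simp add: Fam_def)
      then have "gen_upto (B m) N" using B m(3) by simp
      moreover have "B m \<le> (\<Sum>m\<in>mons d. B m)" using m by (intro member_le_sum) auto
      ultimately show False using N(2) gen_upto_mono by blast
    qed
  qed
  then obtain step where step: "\<And>F. bad F \<Longrightarrow> step F \<notin> up F \<and> bad (insert (step F) F)" by metis
  define Fs where "Fs = rec_nat {} (\<lambda>_ F. insert (step F) F)"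
  have Fs: "Fs 0 = {}" "\<And>n. Fs (Suc n) = insert (step (Fs n)) (Fs n)" by (simp_all add: Fs_def)
  have badn: "bad (Fs n)" for n
  proof (induction n)
    case (Suc n)
    then show ?case using step[of "Fs n"] by (simp add: Fs)
  qed (simp add: Fs bad0)
  have mono: "step (Fs i) \<in> Fs j" if "i < j" for i j
    using that
  proof (induction j)
    case (Suc j)
    then show ?case unfolding Fs by (cases "i = j") (simp_all add: less_Suc_eq)
  qed simp
  obtain i j \<rho> where ij: "i < j" "step (Fs j) = step (Fs i) + \<rho>"
    using dickson[of "\<lambda>n. step (Fs n)"] by (elim exE conjE)
  have "step (Fs j) \<in> up (Fs j)" unfolding up_def
    using ij(2) mono[OF ij(1)] by (intro CollectI exI[of _ "step (Fs i)"] exI[of _ \<rho>] conjI)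
  then show False using step[OF badn] by blast
qed

subsection \<open>Initial subspaces\<close>

lemma wdeg_add [simp]: "wdeg \<omega> (\<nu> + \<mu>) = wdeg \<omega> \<nu> + wdeg \<omega> \<mu>"
  by (simp add: wdeg_def lookup_add distrib_left sum.distrib)

text \<open>Each pair of distinct exponents excludes a hyperplane of weights, and countably many
  hyperplanes have measure zero. Such a weight breaks all ties without an ordering of the index
  type.\<close>

lemma generic_weight_exists: "\<exists>w :: real^'n. inj (wdeg w :: ('n::finite \<Rightarrow>\<^sub>0 nat) \<Rightarrow> real)"
proof -
  define v where "v \<nu> = (\<chi> i. real (Poly_Mapping.lookup \<nu> i))" for \<nu> :: "'n \<Rightarrow>\<^sub>0 nat"
  have wdeg_v: "wdeg w \<nu> = v \<nu> \<bullet> w" for w \<nu>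
    by (simp add: wdeg_def v_def inner_vec_def mult.commute)
  have v_inj: "v \<nu> \<noteq> v \<mu>" if "\<nu> \<noteq> \<mu>" for \<nu> \<mu>
    using that by (auto simp: v_def vec_eq_iff intro: poly_mapping_eqI)
  let ?I = "{(\<nu> :: 'n \<Rightarrow>\<^sub>0 nat, \<mu>). \<nu> \<noteq> \<mu>}"
  have "countable (Poly_Mapping.lookup ` (UNIV :: ('n \<Rightarrow>\<^sub>0 nat) set))"
    by (rule countable_subset[OF subset_UNIV countableI_type])
  then have "countable (UNIV :: ('n \<Rightarrow>\<^sub>0 nat) set)"
    by (rule countable_image_inj_on) (auto intro!: inj_onI poly_mapping_eqI)
  then have "countable (UNIV \<times> UNIV :: (('n \<Rightarrow>\<^sub>0 nat) \<times> ('n \<Rightarrow>\<^sub>0 nat)) set)"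
    by (intro countable_SIGMA)
  then have "countable ?I" by (rule countable_subset[rotated]) auto
  then have "negligible (\<Union>((\<lambda>(\<nu>, \<mu>). {w. (v \<nu> - v \<mu>) \<bullet> w = 0}) ` ?I))"
    by (intro negligible_countable_Union) (auto intro!: negligible_hyperplane simp: v_inj)
  then have "(\<Union>((\<lambda>(\<nu>, \<mu>). {w. (v \<nu> - v \<mu>) \<bullet> w = 0}) ` ?I)) \<noteq> UNIV"
    using non_negligible_UNIV by metis
  then obtain w where w: "\<And>\<nu> \<mu>. \<nu> \<noteq> \<mu> \<Longrightarrow> (v \<nu> - v \<mu>) \<bullet> w \<noteq> 0" by blast
  have "inj (wdeg w :: ('n \<Rightarrow>\<^sub>0 nat) \<Rightarrow> real)"
    by (rule injI) (use w in \<open>auto simp: wdeg_v inner_diff_left\<close>)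
  then show ?thesis by blast
qed

text \<open>The second weight \<open>w\<close> breaks ties; leading exponents are the minimal ones.\<close>
definition wlt :: "real^'n \<Rightarrow> real^'n \<Rightarrow> ('n::finite \<Rightarrow>\<^sub>0 nat) \<Rightarrow> ('n \<Rightarrow>\<^sub>0 nat) \<Rightarrow> bool" where
  "wlt w \<omega> \<nu> \<mu> \<longleftrightarrow> wdeg \<omega> \<nu> < wdeg \<omega> \<mu> \<or> wdeg \<omega> \<nu> = wdeg \<omega> \<mu> \<and> wdeg w \<nu> < wdeg w \<mu>"

lemma wlt_term_order: "inj (wdeg w :: ('n::finite \<Rightarrow>\<^sub>0 nat) \<Rightarrow> real) \<Longrightarrow> term_order (wlt w \<omega> :: ('n \<Rightarrow>\<^sub>0 nat) \<Rightarrow> _)"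
proof (unfold_locales)
  fix a b :: "'n \<Rightarrow>\<^sub>0 nat"
  assume "inj (wdeg w :: ('n \<Rightarrow>\<^sub>0 nat) \<Rightarrow> real)" "a \<noteq> b"
  then have "wdeg w a \<noteq> wdeg w b" by (simp add: inj_eq)
  then show "wlt w \<omega> a b \<or> wlt w \<omega> b a" by (auto simp: wlt_def)
qed (auto simp: wlt_def)

lemma init_form_eq_fpart:
  assumes "Poly_Mapping.lookup f s \<noteq> 0" "\<And>t. Poly_Mapping.lookup f t \<noteq> 0 \<Longrightarrow> wdeg \<omega> s \<le> wdeg \<omega> t"
  shows "init_form \<omega> f = fpart (\<lambda>\<nu>. wdeg \<omega> \<nu> = wdeg \<omega> s) f"
proof -
  have "Min (wdeg \<omega> ` Poly_Mapping.keys f) = wdeg \<omega> s"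
    using assms by (intro Min_eqI) (auto simp: in_keys_iff)
  moreover have "f \<noteq> 0" using assms by auto
  ultimately show ?thesis by (simp add: init_form_def fpart_def)
qed

lemma init_form_0 [simp]: "init_form \<omega> 0 = 0"
  by (simp add: init_form_def)

lemma weight_min_exists:
  assumes "f \<noteq> 0"
  obtains s where "Poly_Mapping.lookup f s \<noteq> 0" "\<And>t. Poly_Mapping.lookup f t \<noteq> 0 \<Longrightarrow> wdeg \<omega> s \<le> wdeg \<omega> t"
proof -
  have ne: "wdeg \<omega> ` Poly_Mapping.keys f \<noteq> {}" using assms by simp
  then have "Min (wdeg \<omega> ` Poly_Mapping.keys f) \<in> wdeg \<omega> ` Poly_Mapping.keys f"
    by (intro Min_in) auto
  then obtain s where "s \<in> Poly_Mapping.keys f" "wdeg \<omega> s = Min (wdeg \<omega> ` Poly_Mapping.keys f)" by auto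
  then show ?thesis using that by (auto simp: in_keys_iff)
qed

lemma lookup_init_form_nz: "Poly_Mapping.lookup (init_form \<omega> f) \<nu> \<noteq> 0 \<Longrightarrow> Poly_Mapping.lookup f \<nu> \<noteq> 0"
proof -
  assume *: "Poly_Mapping.lookup (init_form \<omega> f) \<nu> \<noteq> 0"
  then have "f \<noteq> 0" by auto
  then obtain s where "Poly_Mapping.lookup f s \<noteq> 0" "\<And>t. Poly_Mapping.lookup f t \<noteq> 0 \<Longrightarrow> wdeg \<omega> s \<le> wdeg \<omega> t"
    using weight_min_exists by blast
  from init_form_eq_fpart[OF this] * show ?thesis by (auto split: if_splits)
qed

text \<open>A linear span only; for the degree \<open>d\<close> part of a graded ideal it turns out
  to be the degree \<open>d\<close> part of the initial ideal, see
  \<open>init_ideal_forms\<close>.\<close>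

definition inV :: "real^'n \<Rightarrow> ('n::finite, 'k::field) mpoly set \<Rightarrow> ('n, 'k) mpoly set" where
  "inV \<omega> V = mp.span (init_form \<omega> ` V)"

text \<open>Each pivot has minimal weight in its reduced basis element, so it survives in the
  initial form and \<open>S\<close> stays a pivot set after passing to \<open>inV\<close>.\<close>

definition min_piv :: "real^'n \<Rightarrow> ('n::finite, 'k::field) mpoly set \<Rightarrow> ('n \<Rightarrow>\<^sub>0 nat) set \<Rightarrow> bool" where
  "min_piv \<omega> V S \<longleftrightarrow> piv V S \<and>
     (\<forall>s\<in>S. \<forall>t. Poly_Mapping.lookup (dual V S s) t \<noteq> 0 \<longrightarrow> wdeg \<omega> s \<le> wdeg \<omega> t)"

lemma fpart_sum_cmul: "fpart P (\<Sum>s\<in>S. cmul (c s) (b s)) = (\<Sum>s\<in>S. cmul (c s) (fpart P (b s)))"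
  by (rule poly_mapping_eqI) (simp add: lookup_sum)

lemma piv_span:
  assumes "finite S" "\<And>s t. s \<in> S \<Longrightarrow> t \<in> S \<Longrightarrow> Poly_Mapping.lookup (b s) t = (if t = s then 1 else (0::'k::field))"
  shows "piv (mp.span (b ` S)) S"
  unfolding piv_def
proof (intro conjI ballI impI)
  fix s assume "s \<in> S"
  then show "\<exists>f\<in>mp.span (b ` S). \<forall>t\<in>S. Poly_Mapping.lookup f t = (if t = s then 1 else 0)"
    using assms mp.span_base[of "b s" "b ` S"] by blast
next
  fix f assume f: "f \<in> mp.span (b ` S)" "\<forall>s\<in>S. Poly_Mapping.lookup f s = 0"
  have inj: "inj_on b S" using independent_of_dual assms by blast
  obtain c where "f = (\<Sum>x\<in>b ` S. cmul (c x) x)"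
    using f(1) mp.span_finite[of "b ` S"] assms(1) by auto
  then have c: "f = (\<Sum>s\<in>S. cmul (c (b s)) (b s))" by (simp add: sum.reindex[OF inj])
  have "c (b t) = 0" if "t \<in> S" for t
    using lookup_sum_dual[OF assms(1) that assms(2), of "\<lambda>s. c (b s)"] f(2) that c by simp
  then show "f = 0" unfolding c by (simp add: sum.neutral)
qed fact

lemma init_dual:
  assumes "min_piv \<omega> V S" "s \<in> S"
  shows "init_form \<omega> (dual V S s) = fpart (\<lambda>\<nu>. wdeg \<omega> \<nu> = wdeg \<omega> s) (dual V S s)"
  using assms lookup_dual[of V S s s] by (intro init_form_eq_fpart) (auto simp: min_piv_def)

lemma subspace_inV [simp]: "mp.subspace (inV \<omega> V)"
  by (simp add: inV_def)

text \<open>The initial forms of the reduced basis are still dual to \<open>S\<close>, since pivots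
  survive. They span: let m be the least weight in \<open>f\<close> and take the weight m part of
  its expansion. Pivots occurring in \<open>f\<close> have weight at least m; those of weight m
  contribute their initial forms, and those of larger weight contribute nothing.\<close>

lemma piv_inV:
  assumes V: "mp.subspace V" and S: "min_piv \<omega> V S"
  shows "piv (inV \<omega> V) S"
    and "s \<in> S \<Longrightarrow> dual (inV \<omega> V) S s = init_form \<omega> (dual V S s)"
proof -
  have P: "piv V S" using S by (simp add: min_piv_def)
  let ?e = "\<lambda>s. init_form \<omega> (dual V S s)"
  have e: "Poly_Mapping.lookup (?e s) t = (if t = s then 1 else 0)" if "s \<in> S" "t \<in> S" for s t
    using that by (simp add: init_dual[OF S] lookup_dual[OF P])
  have "init_form \<omega> f \<in> mp.span (?e ` S)" if f: "f \<in> V" for f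
  proof (cases "f = 0")
    case True
    then show ?thesis by (simp add: mp.span_zero)
  next
    case False
    then obtain u where u: "Poly_Mapping.lookup f u \<noteq> 0"
      "\<And>t. Poly_Mapping.lookup f t \<noteq> 0 \<Longrightarrow> wdeg \<omega> u \<le> wdeg \<omega> t"
      using weight_min_exists by blast
    let ?Q = "\<lambda>\<nu>. wdeg \<omega> \<nu> = wdeg \<omega> u"
    have "init_form \<omega> f = fpart ?Q f" using u by (intro init_form_eq_fpart)
    also have "\<dots> = (\<Sum>s\<in>S. cmul (Poly_Mapping.lookup f s) (fpart ?Q (dual V S s)))"
      by (subst dual_expansion[OF V P f]) (rule fpart_sum_cmul)
    also have "\<dots> \<in> mp.span (?e ` S)"
    proof (rule mp.span_sum)
      fix s assume s: "s \<in> S"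
      consider "Poly_Mapping.lookup f s = 0" | "wdeg \<omega> u = wdeg \<omega> s" | "wdeg \<omega> u < wdeg \<omega> s"
        using u(2)[of s] by force
      then show "cmul (Poly_Mapping.lookup f s) (fpart ?Q (dual V S s)) \<in> mp.span (?e ` S)"
      proof cases
        case 2
        then show ?thesis using s by (intro mp.span_scale mp.span_base) (simp add: init_dual[OF S s, symmetric])
      next
        case 3
        then have "fpart ?Q (dual V S s) = 0"
          using S s by (intro poly_mapping_eqI) (force simp: min_piv_def)
        then show ?thesis by (simp add: mp.span_zero)
      qed (simp add: mp.span_zero)
    qed
    finally show ?thesis .
  qed
  then have "mp.span (init_form \<omega> ` V) \<subseteq> mp.span (?e ` S)"
    by (intro mp.span_minimal) auto
  moreover have "mp.span (?e ` S) \<subseteq> mp.span (init_form \<omega> ` V)"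
    using dual_in[OF P] by (intro mp.span_mono) auto
  ultimately have eq: "inV \<omega> V = mp.span (?e ` S)" unfolding inV_def by simp
  show P': "piv (inV \<omega> V) S" unfolding eq using e piv_finite[OF P] by (rule piv_span[rotated])
  show "dual (inV \<omega> V) S s = ?e s" if s: "s \<in> S" for s
    by (rule dual_eqI[OF _ P' s, symmetric]) (use e s in \<open>auto simp: eq intro: mp.span_base\<close>)
qed

definition supported :: "'a set \<Rightarrow> ('a \<Rightarrow>\<^sub>0 'k::zero) set" where
  "supported X = {f. \<forall>\<nu>. Poly_Mapping.lookup f \<nu> \<noteq> 0 \<longrightarrow> \<nu> \<in> X}"

lemma subspace_supported: "mp.subspace (supported X)"
  by (rule mp.subspaceI) (auto simp: supported_def lookup_add, metis add.right_neutral)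

lemma inV_supported: "V \<subseteq> supported X \<Longrightarrow> inV \<omega> V \<subseteq> supported X"
  unfolding inV_def
  by (rule mp.span_minimal[OF _ subspace_supported]) (auto simp: supported_def dest: lookup_init_form_nz)

lemma (in term_order) leads_subset: "V \<subseteq> supported X \<Longrightarrow> leads V \<subseteq> X"
  by (auto simp: leads_def is_lead_def supported_def)

locale generic_weight =
  fixes w :: "real^'n::finite"
  assumes inj_w: "inj (wdeg w :: ('n \<Rightarrow>\<^sub>0 nat) \<Rightarrow> real)"
begin

text \<open>The parameter \<omega> stays free, because orders for different weights, including
  weight 0, are compared with the same tie-breaker \<open>w\<close>.\<close>

sublocale o: term_order "wlt w \<omega> :: ('n \<Rightarrow>\<^sub>0 nat) \<Rightarrow> _" for \<omega>
  by (rule wlt_term_order[OF inj_w])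

lemma min_piv_leads:
  assumes "mp.subspace V" "finite X" "V \<subseteq> supported X"
  shows "min_piv \<omega> V (o.leads \<omega> V)"
proof -
  have fin: "finite (o.leads \<omega> V)" by (rule finite_subset[OF o.leads_subset[OF assms(3)] assms(2)])
  have "piv V (o.leads \<omega> V)" by (rule o.piv_leads[OF assms(1) fin])
  moreover have "\<forall>s\<in>o.leads \<omega> V. \<forall>t. Poly_Mapping.lookup (dual V (o.leads \<omega> V) s) t \<noteq> 0 \<longrightarrow> wdeg \<omega> s \<le> wdeg \<omega> t"
  proof (intro ballI allI impI)
    fix s t assume "s \<in> o.leads \<omega> V" "Poly_Mapping.lookup (dual V (o.leads \<omega> V) s) t \<noteq> 0"
    then have "\<not> wlt w \<omega> t s"
      using o.is_lead_dual[OF assms(1) fin] by (auto simp: o.is_lead_def)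
    then show "wdeg \<omega> s \<le> wdeg \<omega> t" by (auto simp: wlt_def)
  qed
  ultimately show ?thesis by (simp add: min_piv_def)
qed

lemma is_lead_init_form:
  assumes "o.is_lead \<omega> f \<nu>"
  shows "o.is_lead 0 (init_form \<omega> f) \<nu>"
proof -
  have nz: "Poly_Mapping.lookup f \<nu> \<noteq> 0" and min: "\<And>t. Poly_Mapping.lookup f t \<noteq> 0 \<Longrightarrow> \<not> wlt w \<omega> t \<nu>"
    using assms by (auto simp: o.is_lead_def)
  have le: "wdeg \<omega> \<nu> \<le> wdeg \<omega> t" if "Poly_Mapping.lookup f t \<noteq> 0" for t
    using min[OF that] by (auto simp: wlt_def)
  have e: "init_form \<omega> f = fpart (\<lambda>t. wdeg \<omega> t = wdeg \<omega> \<nu>) f"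
    using nz le by (rule init_form_eq_fpart)
  show ?thesis
    unfolding e o.is_lead_def
  proof (intro conjI allI impI)
    fix t assume "Poly_Mapping.lookup (fpart (\<lambda>t. wdeg \<omega> t = wdeg \<omega> \<nu>) f) t \<noteq> 0"
    then have "Poly_Mapping.lookup f t \<noteq> 0" "wdeg \<omega> t = wdeg \<omega> \<nu>" by (auto split: if_splits)
    then show "\<not> wlt w 0 t \<nu>" using min by (auto simp: wlt_def wdeg_def)
  qed (use nz in simp)
qed

text \<open>With weight 0 only the tie-breaker \<open>w\<close> remains. One inclusion is
  \<open>is_lead_init_form\<close>, and the dimension of \<open>inV \<omega> V\<close> forces
  equality. Hence the leading exponents depend on \<omega> only through
  \<open>inV \<omega> V\<close>, which gives weights with the same initial subspace a common pivot
  set.\<close>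

lemma leads_inV:
  assumes "mp.subspace V" "finite X" "V \<subseteq> supported X"
  shows "o.leads \<omega> V = o.leads 0 (inV \<omega> V)"
proof (rule card_subset_eq)
  have S: "inV \<omega> V \<subseteq> supported X" by (rule inV_supported) fact
  have fin: "finite (o.leads 0 (inV \<omega> V))" by (rule finite_subset[OF o.leads_subset[OF S] assms(2)])
  show "finite (o.leads 0 (inV \<omega> V))" by fact
  show "o.leads \<omega> V \<subseteq> o.leads 0 (inV \<omega> V)"
  proof
    fix \<nu> assume "\<nu> \<in> o.leads \<omega> V"
    then obtain f where "f \<in> V" "o.is_lead \<omega> f \<nu>" by (auto simp: o.leads_def)
    moreover from this have "init_form \<omega> f \<in> inV \<omega> V" by (auto simp: inV_def intro: mp.span_base)
    ultimately show "\<nu> \<in> o.leads 0 (inV \<omega> V)" using is_lead_init_form by (auto simp: o.leads_def)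
  qed
  have "card (o.leads \<omega> V) = mp.dim (inV \<omega> V)"
    using piv_dim[OF subspace_inV piv_inV(1)[OF assms(1) min_piv_leads[OF assms]]] by simp
  also have "\<dots> = card (o.leads 0 (inV \<omega> V))"
    by (rule piv_dim[OF subspace_inV o.piv_leads[OF subspace_inV fin]])
  finally show "card (o.leads \<omega> V) = card (o.leads 0 (inV \<omega> V))" .
qed

end

text \<open>The condition \<open>min_piv\<close> with all polynomials removed: a matroid basis of
  minimum weight, tested by single exchanges. \<open>P\<close> is an abstract family so that nothing
  but the matroid can enter.\<close>

definition min_basis :: "real^'n \<Rightarrow> ('n::finite \<Rightarrow>\<^sub>0 nat) set set \<Rightarrow> ('n \<Rightarrow>\<^sub>0 nat) set \<Rightarrow> bool" where
  "min_basis \<omega> P S \<longleftrightarrow> S \<in> P \<and>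
     (\<forall>s\<in>S. \<forall>t. t \<notin> S \<longrightarrow> insert t (S - {s}) \<in> P \<longrightarrow> wdeg \<omega> s \<le> wdeg \<omega> t)"

lemma min_piv_iff:
  assumes "mp.subspace V"
  shows "min_piv \<omega> V S \<longleftrightarrow> min_basis \<omega> {S. piv V S} S"
proof (cases "piv V S")
  case True
  have "(Poly_Mapping.lookup (dual V S s) t \<noteq> 0 \<longrightarrow> wdeg \<omega> s \<le> wdeg \<omega> t) \<longleftrightarrow>
      (t \<notin> S \<longrightarrow> piv V (insert t (S - {s})) \<longrightarrow> wdeg \<omega> s \<le> wdeg \<omega> t)" if "s \<in> S" for s t
    using piv_exchange[OF assms True that, of t] lookup_dual[OF True that, of t] by (cases "t \<in> S") auto
  then show ?thesis using True by (simp add: min_piv_def min_basis_def)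
qed (simp add: min_piv_def min_basis_def)

text \<open>An initial subspace is determined by the initial forms of a reduced basis with weight
  minimal pivots, and a term t of the element with pivot s survives exactly when t has the weight of
  s. By \<open>piv_exchange\<close> the supports are expressed through \<open>piv V\<close>, so the
  right-hand side transfers to any space with the same pivot sets. A common \<open>S\<close> for
  both weights exists by \<open>leads_inV\<close>.\<close>

lemma inV_eq_iff:
  fixes V :: "('n::finite, 'k::field) mpoly set"
  assumes V: "mp.subspace V" and X: "finite X" "V \<subseteq> supported X"
  shows "inV \<omega> V = inV \<omega>' V \<longleftrightarrow>
    (\<exists>S. min_basis \<omega> {S. piv V S} S \<and> min_basis \<omega>' {S. piv V S} S \<and>
      (\<forall>s\<in>S. \<forall>t. t \<notin> S \<longrightarrow> piv V (insert t (S - {s})) \<longrightarrow>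
        (wdeg \<omega> s = wdeg \<omega> t \<longleftrightarrow> wdeg \<omega>' s = wdeg \<omega>' t)))" (is "?L \<longleftrightarrow> (\<exists>S. ?R S)")
proof
  assume eq: ?L
  obtain w :: "real^'n" where "inj (wdeg w :: ('n \<Rightarrow>\<^sub>0 nat) \<Rightarrow> real)" using generic_weight_exists by blast
  then interpret generic_weight w by unfold_locales
  let ?S = "o.leads \<omega> V"
  have S': "?S = o.leads \<omega>' V" using leads_inV[OF V X, of \<omega>] leads_inV[OF V X, of \<omega>'] eq by simp
  have 1: "min_piv \<omega> V ?S" and 2: "min_piv \<omega>' V ?S"
    using min_piv_leads[OF V X] S' by metis+
  have P: "piv V ?S" using 1 by (simp add: min_piv_def)
  have "wdeg \<omega> s = wdeg \<omega> t \<longleftrightarrow> wdeg \<omega>' s = wdeg \<omega>' t"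
    if st: "s \<in> ?S" "t \<notin> ?S" "piv V (insert t (?S - {s}))" for s t
  proof -
    have "init_form \<omega> (dual V ?S s) = init_form \<omega>' (dual V ?S s)"
      using piv_inV(2)[OF V 1 st(1)] piv_inV(2)[OF V 2 st(1)] eq by simp
    then have "fpart (\<lambda>\<nu>. wdeg \<omega> \<nu> = wdeg \<omega> s) (dual V ?S s) = fpart (\<lambda>\<nu>. wdeg \<omega>' \<nu> = wdeg \<omega>' s) (dual V ?S s)"
      using st(1) 1 2 by (simp add: init_dual)
    then have "Poly_Mapping.lookup (fpart (\<lambda>\<nu>. wdeg \<omega> \<nu> = wdeg \<omega> s) (dual V ?S s)) t
        = Poly_Mapping.lookup (fpart (\<lambda>\<nu>. wdeg \<omega>' \<nu> = wdeg \<omega>' s) (dual V ?S s)) t"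
      by simp
    moreover have "Poly_Mapping.lookup (dual V ?S s) t \<noteq> 0" using piv_exchange[OF V P st(1,2)] st(3) by simp
    ultimately show ?thesis by (auto split: if_splits)
  qed
  then have "\<forall>s\<in>?S. \<forall>t. t \<notin> ?S \<longrightarrow> piv V (insert t (?S - {s})) \<longrightarrow>
      (wdeg \<omega> s = wdeg \<omega> t \<longleftrightarrow> wdeg \<omega>' s = wdeg \<omega>' t)"
    by (intro ballI allI impI)
  moreover note 1[unfolded min_piv_iff[OF V]] 2[unfolded min_piv_iff[OF V]]
  ultimately show "\<exists>S. ?R S" by (intro exI[of _ ?S] conjI)
next
  assume "\<exists>S. ?R S"
  then obtain S where S: "?R S" by blast
  then have 1: "min_piv \<omega> V S" and 2: "min_piv \<omega>' V S" by (simp_all add: min_piv_iff[OF V])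
  have P: "piv V S" using 1 by (simp add: min_piv_def)
  have eq: "init_form \<omega> (dual V S s) = init_form \<omega>' (dual V S s)" if s: "s \<in> S" for s
    unfolding init_dual[OF 1 s] init_dual[OF 2 s]
  proof (rule poly_mapping_eqI)
    fix t
    consider "t = s" | "Poly_Mapping.lookup (dual V S s) t = 0" | "t \<notin> S" "piv V (insert t (S - {s}))"
      using lookup_dual[OF P s, of t] piv_exchange[OF V P s, of t] by fastforce
    then show "Poly_Mapping.lookup (fpart (\<lambda>\<nu>. wdeg \<omega> \<nu> = wdeg \<omega> s) (dual V S s)) t =
        Poly_Mapping.lookup (fpart (\<lambda>\<nu>. wdeg \<omega>' \<nu> = wdeg \<omega>' s) (dual V S s)) t"
    proof cases
      case 3
      then have "wdeg \<omega> s = wdeg \<omega> t \<longleftrightarrow> wdeg \<omega>' s = wdeg \<omega>' t" using S s by blast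
      then show ?thesis by (auto simp: eq_commute[of "wdeg _ t"])
    qed simp_all
  qed
  have "inV \<omega>'' V = mp.span (dual (inV \<omega>'' V) S ` S)" if "min_piv \<omega>'' V S" for \<omega>''
  proof -
    note P' = piv_inV(1)[OF V that]
    have "f \<in> mp.span (dual (inV \<omega>'' V) S ` S)" if "f \<in> inV \<omega>'' V" for f
      by (subst dual_expansion[OF subspace_inV P' that])
        (intro mp.span_sum mp.span_scale mp.span_base imageI)
    moreover have "mp.span (dual (inV \<omega>'' V) S ` S) \<subseteq> inV \<omega>'' V"
      using dual_in[OF P'] by (intro mp.span_minimal) auto
    ultimately show ?thesis by blast
  qed
  moreover have "dual (inV \<omega> V) S ` S = dual (inV \<omega>' V) S ` S"
    using piv_inV(2)[OF V 1] piv_inV(2)[OF V 2] eq by (intro image_cong) auto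
  ultimately show ?L using 1 2 by metis
qed

text \<open>A monomial in a space with pivot set \<open>S\<close> has its exponent in
  \<open>S\<close>, as otherwise it would vanish on \<open>S\<close>; it is then the reduced basis
  element for that pivot. So the initial form of \<open>dual V S \<nu>\<close> must be a single
  term: no other exponent in its support has the weight of \<nu>.\<close>

lemma monomial_in_inV_iff:
  fixes V :: "('n::finite, 'k::field) mpoly set"
  assumes V: "mp.subspace V" and X: "finite X" "V \<subseteq> supported X"
  shows "Poly_Mapping.single \<nu> 1 \<in> inV \<omega> V \<longleftrightarrow>
    (\<exists>S. min_basis \<omega> {S. piv V S} S \<and> \<nu> \<in> S \<and>
      (\<forall>t. t \<notin> S \<longrightarrow> piv V (insert t (S - {\<nu>})) \<longrightarrow> wdeg \<omega> \<nu> \<noteq> wdeg \<omega> t))" (is "?L \<longleftrightarrow> (\<exists>S. ?R S)")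
proof
  assume m: ?L
  obtain w :: "real^'n" where "inj (wdeg w :: ('n \<Rightarrow>\<^sub>0 nat) \<Rightarrow> real)" using generic_weight_exists by blast
  then interpret generic_weight w by unfold_locales
  let ?S = "o.leads \<omega> V"
  have 1: "min_piv \<omega> V ?S" using min_piv_leads[OF V X] .
  have P: "piv V ?S" using 1 by (simp add: min_piv_def)
  note P' = piv_inV(1)[OF V 1]
  have \<nu>: "\<nu> \<in> ?S"
  proof (rule ccontr)
    assume "\<nu> \<notin> ?S"
    then have "Poly_Mapping.single \<nu> 1 = (0 :: ('n, 'k) mpoly)"
      by (intro pivD0[OF P' m]) (auto simp: lookup_single when_def)
    then show False by (metis lookup_single_eq lookup_zero zero_neq_one)
  qed
  have "Poly_Mapping.single \<nu> 1 = dual (inV \<omega> V) ?S \<nu>"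
    by (rule dual_eqI[OF subspace_inV P' \<nu> m]) (auto simp: lookup_single when_def)
  then have e: "Poly_Mapping.single \<nu> 1 = fpart (\<lambda>\<mu>. wdeg \<omega> \<mu> = wdeg \<omega> \<nu>) (dual V ?S \<nu>)"
    using piv_inV(2)[OF V 1 \<nu>] init_dual[OF 1 \<nu>] by simp
  have "wdeg \<omega> \<nu> \<noteq> wdeg \<omega> t" if t: "t \<notin> ?S" "piv V (insert t (?S - {\<nu>}))" for t
  proof
    assume "wdeg \<omega> \<nu> = wdeg \<omega> t"
    then have "Poly_Mapping.lookup (Poly_Mapping.single \<nu> 1) t = Poly_Mapping.lookup (dual V ?S \<nu>) t"
      unfolding e by simp
    moreover have "Poly_Mapping.lookup (dual V ?S \<nu>) t \<noteq> 0" using piv_exchange[OF V P \<nu> t(1)] t(2) by simp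
    moreover have "\<nu> \<noteq> t" using \<nu> t by auto
    ultimately show False by (simp add: lookup_single)
  qed
  then have "\<forall>t. t \<notin> ?S \<longrightarrow> piv V (insert t (?S - {\<nu>})) \<longrightarrow> wdeg \<omega> \<nu> \<noteq> wdeg \<omega> t"
    by (intro allI impI)
  with 1[unfolded min_piv_iff[OF V]] \<nu> show "\<exists>S. ?R S" by (intro exI[of _ ?S] conjI)
next
  assume "\<exists>S. ?R S"
  then obtain S where S: "?R S" by blast
  then have 1: "min_piv \<omega> V S" and \<nu>: "\<nu> \<in> S" by (simp_all add: min_piv_iff[OF V])
  have P: "piv V S" using 1 by (simp add: min_piv_def)
  have "init_form \<omega> (dual V S \<nu>) = Poly_Mapping.single \<nu> 1"
    unfolding init_dual[OF 1 \<nu>]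
  proof (rule poly_mapping_eqI)
    fix t
    consider "t = \<nu>" | "t \<noteq> \<nu>" "Poly_Mapping.lookup (dual V S \<nu>) t = 0" | "t \<notin> S" "piv V (insert t (S - {\<nu>}))"
      using lookup_dual[OF P \<nu>, of t] piv_exchange[OF V P \<nu>, of t] by fastforce
    then show "Poly_Mapping.lookup (fpart (\<lambda>\<mu>. wdeg \<omega> \<mu> = wdeg \<omega> \<nu>) (dual V S \<nu>)) t =
        Poly_Mapping.lookup (Poly_Mapping.single \<nu> 1) t"
    proof cases
      case 3
      then have "wdeg \<omega> \<nu> \<noteq> wdeg \<omega> t" using S by blast
      then show ?thesis using 3 \<nu> by (auto simp: lookup_single when_def)
    qed (simp_all add: lookup_single when_def lookup_dual[OF P \<nu> \<nu>])
  qed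
  moreover have "init_form \<omega> (dual V S \<nu>) \<in> inV \<omega> V"
    unfolding inV_def using dual_in[OF P \<nu>] by (intro mp.span_base imageI)
  ultimately show ?L by simp
qed

subsection \<open>Initial ideals of graded ideals\<close>

lemma subspace_ideal: "is_ideal J \<Longrightarrow> mp.subspace J"
  by (rule mp.subspaceI) (auto simp: is_ideal_def cmul_def)

lemma ideal_0: "is_ideal J \<Longrightarrow> 0 \<in> J"
  and ideal_add: "is_ideal J \<Longrightarrow> a \<in> J \<Longrightarrow> b \<in> J \<Longrightarrow> a + b \<in> J"
  and ideal_mult: "is_ideal J \<Longrightarrow> a \<in> J \<Longrightarrow> r * a \<in> J"
  by (simp_all add: is_ideal_def)

lemma is_ideal_ideal_gen: "is_ideal (ideal_gen S)"
  by (auto simp: ideal_gen_def is_ideal_def)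

lemma ideal_gen_superset: "S \<subseteq> ideal_gen S"
  by (auto simp: ideal_gen_def)

lemma ideal_gen_minimal: "is_ideal J \<Longrightarrow> S \<subseteq> J \<Longrightarrow> ideal_gen S \<subseteq> J"
  by (auto simp: ideal_gen_def)

section \<open>Multiplication by monomials and homogeneous components\<close>

lemma sum_singles: "(\<Sum>\<nu>\<in>Poly_Mapping.keys f. Poly_Mapping.single \<nu> (Poly_Mapping.lookup f \<nu>)) = f"
proof -
  have "(\<Sum>\<nu>\<in>Poly_Mapping.keys f. Poly_Mapping.single \<nu> (Poly_Mapping.lookup f \<nu>)) = fpart (\<lambda>_. True) f"
    by (simp add: fpart_def)
  also have "\<dots> = f" by (rule poly_mapping_eqI) simp
  finally show ?thesis .
qed

lemma single_mult_eq:
  "Poly_Mapping.single \<mu> c * f = (\<Sum>\<nu>\<in>Poly_Mapping.keys f. Poly_Mapping.single (\<mu> + \<nu>) (c * Poly_Mapping.lookup f \<nu>))"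
  by (subst (1) sum_singles[of f, symmetric]) (simp add: sum_distrib_left mult_single)

lemma lookup_single_mult:
  fixes \<mu> :: "'a::cancel_comm_monoid_add"
  shows "Poly_Mapping.lookup (Poly_Mapping.single \<mu> c * f) (\<mu> + \<nu>) = c * Poly_Mapping.lookup f \<nu>"
proof -
  have "Poly_Mapping.lookup (Poly_Mapping.single \<mu> c * f) (\<mu> + \<nu>) =
      (\<Sum>\<xi>\<in>Poly_Mapping.keys f. if \<xi> = \<nu> then c * Poly_Mapping.lookup f \<nu> else 0)"
    unfolding single_mult_eq lookup_sum by (intro sum.cong) (auto simp: lookup_single when_def)
  then show ?thesis by (simp add: in_keys_iff)
qed

lemma lookup_single_mult_nz:
  assumes "Poly_Mapping.lookup (Poly_Mapping.single \<mu> c * f) \<xi> \<noteq> 0"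
  obtains \<nu> where "\<xi> = \<mu> + \<nu>" "Poly_Mapping.lookup f \<nu> \<noteq> 0"
proof -
  have "\<exists>\<nu>\<in>Poly_Mapping.keys f. Poly_Mapping.lookup (Poly_Mapping.single (\<mu> + \<nu>) (c * Poly_Mapping.lookup f \<nu>)) \<xi> \<noteq> 0"
    using assms unfolding single_mult_eq lookup_sum by (meson sum.neutral)
  then show ?thesis using that by (auto simp: lookup_single when_def in_keys_iff split: if_splits)
qed

lemma single_mult_eqI:
  fixes \<mu> :: "'a::cancel_comm_monoid_add" and g :: "'a \<Rightarrow>\<^sub>0 'k::comm_semiring_1"
  assumes "\<And>\<xi>. Poly_Mapping.lookup g \<xi> \<noteq> 0 \<Longrightarrow> \<exists>\<nu>. \<xi> = \<mu> + \<nu>"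
    and "\<And>\<nu>. Poly_Mapping.lookup g (\<mu> + \<nu>) = c * Poly_Mapping.lookup f \<nu>"
  shows "Poly_Mapping.single \<mu> c * f = g"
proof (rule poly_mapping_eqI)
  fix \<xi> show "Poly_Mapping.lookup (Poly_Mapping.single \<mu> c * f) \<xi> = Poly_Mapping.lookup g \<xi>"
  proof (cases "\<exists>\<nu>. \<xi> = \<mu> + \<nu>")
    case True
    then show ?thesis by (auto simp: lookup_single_mult assms(2))
  next
    case False
    then have "Poly_Mapping.lookup g \<xi> = 0" using assms(1) by blast
    moreover have "Poly_Mapping.lookup (Poly_Mapping.single \<mu> c * f) \<xi> = 0"
      using False lookup_single_mult_nz[of \<mu> c f \<xi>] by blast
    ultimately show ?thesis by simp
  qed
qed

lemma hom_comp_eq_fpart: "hom_comp d f = fpart (\<lambda>\<nu>. total_deg \<nu> = d) f"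
  by (simp add: hom_comp_def fpart_def)

lemma lookup_hom_comp [simp]:
  "Poly_Mapping.lookup (hom_comp d f) \<nu> = (if total_deg \<nu> = d then Poly_Mapping.lookup f \<nu> else 0)"
  by (simp add: hom_comp_eq_fpart)

abbreviation forms :: "nat \<Rightarrow> ('n::finite, 'k::zero) mpoly set" where
  "forms d \<equiv> supported (mons d)"

lemma mem_forms: "f \<in> forms d \<longleftrightarrow> (\<forall>\<nu>. Poly_Mapping.lookup f \<nu> \<noteq> 0 \<longrightarrow> total_deg \<nu> = d)"
  by (simp add: supported_def mons_def)

lemma hom_comp_forms [simp]: "hom_comp d f \<in> forms d"
  by (simp add: mem_forms)

lemma hom_comp_of_form: "f \<in> forms e \<Longrightarrow> hom_comp d f = (if d = e then f else 0)"
  by (rule poly_mapping_eqI) (auto simp: mem_forms)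

lemma sum_hom_comp: "f = (\<Sum>d\<in>total_deg ` Poly_Mapping.keys f. hom_comp d f)"
proof (rule poly_mapping_eqI)
  fix \<nu>
  have "Poly_Mapping.lookup (\<Sum>d\<in>total_deg ` Poly_Mapping.keys f. hom_comp d f) \<nu> =
      (\<Sum>d\<in>total_deg ` Poly_Mapping.keys f. if d = total_deg \<nu> then Poly_Mapping.lookup f \<nu> else 0)"
    unfolding lookup_sum by (intro sum.cong) auto
  also have "\<dots> = Poly_Mapping.lookup f \<nu>" by (auto simp: in_keys_iff)
  finally show "Poly_Mapping.lookup f \<nu> = Poly_Mapping.lookup (\<Sum>d\<in>total_deg ` Poly_Mapping.keys f. hom_comp d f) \<nu>" ..
qed

lemma mem_of_hom_comp:
  assumes "mp.subspace J" "\<And>d. hom_comp d f \<in> J"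
  shows "f \<in> J"
  by (subst sum_hom_comp) (intro mp.subspace_sum assms)

lemma single_mult_forms: "f \<in> forms d \<Longrightarrow> Poly_Mapping.single \<mu> c * f \<in> forms (d + total_deg \<mu>)"
  by (auto simp: mem_forms elim!: lookup_single_mult_nz)

lemma graded_ideal_is_ideal: "graded_ideal J \<Longrightarrow> is_ideal J"
  by (simp add: graded_ideal_def)

lemma subspace_form_part: "is_ideal J \<Longrightarrow> mp.subspace (J \<inter> forms d)"
  by (intro mp.subspace_inter subspace_ideal subspace_supported)

lemma graded_ideal_eqI:
  fixes J K :: "('n::finite, 'k::field) mpoly set"
  assumes "graded_ideal J" "graded_ideal K" "\<And>d. J \<inter> forms d = K \<inter> forms d"
  shows "J = K"
proof -
  have "A \<subseteq> B" if "graded_ideal A" "graded_ideal B" "\<And>d. A \<inter> forms d = B \<inter> forms d" for A B :: "('n, 'k) mpoly set"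
  proof
    fix f assume "f \<in> A"
    then have "hom_comp d f \<in> A \<inter> forms d" for d using that(1) by (simp add: graded_ideal_def)
    then have "hom_comp d f \<in> B" for d using that(3) by blast
    then show "f \<in> B" by (rule mem_of_hom_comp[OF subspace_ideal[OF graded_ideal_is_ideal[OF that(2)]]])
  qed
  from this[of J K] this[of K J] show ?thesis using assms by auto
qed

lemma init_form_single_mult:
  fixes f :: "('n::finite, 'k::field) mpoly"
  assumes "c \<noteq> 0"
  shows "init_form \<omega> (Poly_Mapping.single \<mu> c * f) = Poly_Mapping.single \<mu> c * init_form \<omega> f"
proof (cases "f = 0")
  case False
  then obtain s where s: "Poly_Mapping.lookup f s \<noteq> 0"
    "\<And>t. Poly_Mapping.lookup f t \<noteq> 0 \<Longrightarrow> wdeg \<omega> s \<le> wdeg \<omega> t"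
    using weight_min_exists by blast
  let ?g = "Poly_Mapping.single \<mu> c * f"
  have e: "init_form \<omega> ?g = fpart (\<lambda>\<nu>. wdeg \<omega> \<nu> = wdeg \<omega> (\<mu> + s)) ?g"
    by (rule init_form_eq_fpart) (use s assms in \<open>auto simp: lookup_single_mult elim!: lookup_single_mult_nz\<close>)
  have e': "init_form \<omega> f = fpart (\<lambda>\<nu>. wdeg \<omega> \<nu> = wdeg \<omega> s) f" using s by (rule init_form_eq_fpart)
  show ?thesis
    unfolding e e'
    by (rule sym, rule single_mult_eqI)
      (auto simp: lookup_single_mult elim!: lookup_single_mult_nz split: if_splits)
qed simp

lemma single_mult_inV:
  fixes J :: "('n::finite, 'k::field) mpoly set"
  assumes J: "is_ideal J" and g: "g \<in> inV \<omega> (J \<inter> forms d)"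
  shows "Poly_Mapping.single \<mu> c * g \<in> inV \<omega> (J \<inter> forms (d + total_deg \<mu>))"
proof (cases "c = 0")
  case True
  then show ?thesis by (simp add: mp.subspace_0)
next
  case False
  show ?thesis
    using g unfolding inV_def[of _ "J \<inter> forms d"]
  proof (induction rule: mp.span_induct_alt)
    case base
    then show ?case by (simp add: mp.subspace_0)
  next
    case (step a x y)
    then obtain f where f: "f \<in> J" "f \<in> forms d" "x = init_form \<omega> f" by auto
    have "Poly_Mapping.single \<mu> c * x = init_form \<omega> (Poly_Mapping.single \<mu> c * f)"
      by (simp only: f(3) init_form_single_mult[OF False])
    also have "\<dots> \<in> inV \<omega> (J \<inter> forms (d + total_deg \<mu>))"
      unfolding inV_def by (intro mp.span_base imageI IntI ideal_mult J f single_mult_forms)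
    finally have "cmul a (Poly_Mapping.single \<mu> c * x) + Poly_Mapping.single \<mu> c * y
        \<in> inV \<omega> (J \<inter> forms (d + total_deg \<mu>))"
      using step by (intro mp.subspace_add mp.subspace_scale) auto
    then show ?case by (simp add: cmul_def algebra_simps)
  qed
qed

text \<open>The alternatives distinguish whether the least weight of \<open>f\<close> is attained in
  degree \<open>d\<close>.\<close>

lemma hom_comp_init_form:
  "hom_comp d (init_form \<omega> f) = 0 \<or> hom_comp d (init_form \<omega> f) = init_form \<omega> (hom_comp d f)"
proof (cases "f = 0")
  case True
  then show ?thesis by (auto intro!: disjI1 poly_mapping_eqI)
next
  case False
  then obtain u where u: "Poly_Mapping.lookup f u \<noteq> 0"
    "\<And>t. Poly_Mapping.lookup f t \<noteq> 0 \<Longrightarrow> wdeg \<omega> u \<le> wdeg \<omega> t"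
    using weight_min_exists by blast
  have e: "init_form \<omega> f = fpart (\<lambda>\<nu>. wdeg \<omega> \<nu> = wdeg \<omega> u) f" using u by (rule init_form_eq_fpart)
  show ?thesis
  proof (cases "hom_comp d (init_form \<omega> f) = 0")
    case False
    then obtain s where "Poly_Mapping.lookup (hom_comp d (init_form \<omega> f)) s \<noteq> 0"
      using weight_min_exists[OF False] by blast
    then have s: "total_deg s = d" "wdeg \<omega> s = wdeg \<omega> u" "Poly_Mapping.lookup f s \<noteq> 0"
      by (auto simp: e split: if_splits)
    have "init_form \<omega> (hom_comp d f) = fpart (\<lambda>\<nu>. wdeg \<omega> \<nu> = wdeg \<omega> s) (hom_comp d f)"
      by (rule init_form_eq_fpart) (use s u in \<open>auto split: if_splits\<close>)
    also have "\<dots> = hom_comp d (init_form \<omega> f)"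
      unfolding e by (rule poly_mapping_eqI) (simp add: s)
    finally show ?thesis by simp
  qed simp
qed

lemma hom_comp_add: "hom_comp d (f + g) = hom_comp d f + hom_comp d g"
  by (rule poly_mapping_eqI) (simp add: lookup_add)

lemma inV_forms: "V \<subseteq> forms d \<Longrightarrow> g \<in> inV \<omega> V \<Longrightarrow> g \<in> forms d"
  using inV_supported by blast

text \<open>The right-hand side is closed under multiplication because a product splits into
  monomials times forms, and a monomial carries the initial subspace of one degree into that of
  another (\<open>single_mult_inV\<close>). It contains the initial forms by
  \<open>hom_comp_init_form\<close>, where gradedness of \<open>J\<close> keeps the components of
  \<open>f\<close> in \<open>J\<close>.\<close>

lemma init_ideal_eq:
  fixes J :: "('n::finite, 'k::field) mpoly set"
  assumes J: "graded_ideal J"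
  shows "init_ideal \<omega> J = {h. \<forall>d. hom_comp d h \<in> inV \<omega> (J \<inter> forms d)}" (is "_ = ?K")
proof
  note iJ = graded_ideal_is_ideal[OF J]
  have K_form: "g \<in> ?K" if "g \<in> inV \<omega> (J \<inter> forms d)" for g d
    using hom_comp_of_form[OF inV_forms[OF Int_lower2 that]] that by (auto simp: mp.subspace_0)
  have K0: "0 \<in> ?K" using K_form[of 0 0] by (simp add: mp.subspace_0)
  have K_add: "a + b \<in> ?K" if "a \<in> ?K" "b \<in> ?K" for a b
    using that by (simp add: hom_comp_add mp.subspace_add)
  have K_sum: "(\<Sum>i\<in>A. F i) \<in> ?K" if "\<And>i. i \<in> A \<Longrightarrow> F i \<in> ?K" for A :: "'c set" and F
    using that by (induction A rule: infinite_finite_induct) (simp_all only: sum.infinite sum.empty sum.insert K0 K_add insert_iff simp_thms)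
  have "is_ideal ?K"
    unfolding is_ideal_def
  proof (intro conjI ballI allI)
    fix r h assume h: "h \<in> ?K"
    have "r * h = (\<Sum>\<mu>\<in>Poly_Mapping.keys r. \<Sum>d\<in>total_deg ` Poly_Mapping.keys h.
        Poly_Mapping.single \<mu> (Poly_Mapping.lookup r \<mu>) * hom_comp d h)"
      by (subst (1) sum_hom_comp[of h], subst (1) sum_singles[of r, symmetric]) (simp add: sum_product)
    also have "\<dots> \<in> ?K"
    proof (intro K_sum)
      fix \<mu> d
      have "hom_comp d h \<in> inV \<omega> (J \<inter> forms d)" using h by simp
      then show "Poly_Mapping.single \<mu> (Poly_Mapping.lookup r \<mu>) * hom_comp d h \<in> ?K"
        by (rule K_form[OF single_mult_inV[OF iJ]])
    qed
    finally show "r * h \<in> ?K" .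
  qed (use K0 K_add in auto)
  moreover have "init_form \<omega> f \<in> ?K" if f: "f \<in> J" for f
  proof -
    have "hom_comp d (init_form \<omega> f) \<in> inV \<omega> (J \<inter> forms d)" for d
    proof -
      have "init_form \<omega> (hom_comp d f) \<in> inV \<omega> (J \<inter> forms d)"
        unfolding inV_def using J f by (intro mp.span_base imageI) (simp add: graded_ideal_def)
      then show ?thesis using hom_comp_init_form[of d \<omega> f] by (auto simp: mp.subspace_0)
    qed
    then show ?thesis by simp
  qed
  ultimately show "init_ideal \<omega> J \<subseteq> ?K"
    unfolding init_ideal_def by (intro ideal_gen_minimal) auto
  have "inV \<omega> (J \<inter> forms d) \<subseteq> init_ideal \<omega> J" for d
    unfolding inV_def init_ideal_def
    using ideal_gen_superset[of "init_form \<omega> ` J"]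
    by (intro mp.span_minimal subspace_ideal is_ideal_ideal_gen) auto
  then show "?K \<subseteq> init_ideal \<omega> J"
    using mem_of_hom_comp[OF subspace_ideal[OF is_ideal_ideal_gen]] unfolding init_ideal_def by blast
qed

lemma init_ideal_forms:
  fixes J :: "('n::finite, 'k::field) mpoly set"
  assumes J: "graded_ideal J"
  shows "init_ideal \<omega> J \<inter> forms d = inV \<omega> (J \<inter> forms d)"
proof -
  have "g \<in> init_ideal \<omega> J \<longleftrightarrow> g \<in> inV \<omega> (J \<inter> forms d)" if g: "g \<in> forms d" for g
    unfolding init_ideal_eq[OF J] using hom_comp_of_form[OF g] by (auto simp: mp.subspace_0)
  then show ?thesis using inV_forms[of "J \<inter> forms d" d] by blast
qed

lemma graded_init_ideal:
  fixes J :: "('n::finite, 'k::field) mpoly set"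
  assumes J: "graded_ideal J"
  shows "graded_ideal (init_ideal \<omega> J)"
  unfolding graded_ideal_def
proof (intro conjI ballI allI)
  show "is_ideal (init_ideal \<omega> J)" unfolding init_ideal_def by (rule is_ideal_ideal_gen)
  fix f d assume "f \<in> init_ideal \<omega> J"
  then have "hom_comp d f \<in> inV \<omega> (J \<inter> forms d)" unfolding init_ideal_eq[OF J] by blast
  then show "hom_comp d f \<in> init_ideal \<omega> J" using init_ideal_forms[OF J] by blast
qed

text \<open>Both spaces have the pivot set \<open>o.leads \<omega> V\<close>. In each degree this
  says that a graded ideal and its initial ideals share their Hilbert function.\<close>

lemma dim_inV:
  fixes V :: "('n::finite, 'k::field) mpoly set" and \<omega> :: "real^'n"
  assumes "mp.subspace V" "finite X" "V \<subseteq> supported X"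
  shows "mp.dim (inV \<omega> V) = mp.dim V"
proof -
  obtain w :: "real^'n" where "inj (wdeg w :: ('n \<Rightarrow>\<^sub>0 nat) \<Rightarrow> real)" using generic_weight_exists by blast
  then interpret generic_weight w by unfold_locales
  have m: "min_piv \<omega> V (o.leads \<omega> V)" by (rule min_piv_leads[OF assms])
  have "mp.dim (inV \<omega> V) = card (o.leads \<omega> V)"
    by (rule piv_dim[OF subspace_inV piv_inV(1)[OF assms(1) m]])
  also have "\<dots> = mp.dim V"
  proof -
    have "piv V (o.leads \<omega> V)" using m by (simp add: min_piv_def)
    from piv_dim[OF assms(1) this] show ?thesis by simp
  qed
  finally show ?thesis .
qed

subsection \<open>Degree bounds\<close>

lemma (in generic_weight) is_lead_shift:
  fixes f :: "('n, 'k::field) mpoly"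
  assumes "o.is_lead \<omega> f \<nu>"
  shows "o.is_lead \<omega> (Poly_Mapping.single \<mu> 1 * f) (\<mu> + \<nu>)"
  unfolding o.is_lead_def
proof (intro conjI allI impI)
  show "Poly_Mapping.lookup (Poly_Mapping.single \<mu> 1 * f) (\<mu> + \<nu>) \<noteq> 0"
    using assms by (simp add: lookup_single_mult o.is_lead_def)
  fix \<xi> assume "Poly_Mapping.lookup (Poly_Mapping.single \<mu> 1 * f) \<xi> \<noteq> 0"
  then obtain \<rho> where \<rho>: "\<xi> = \<mu> + \<rho>" "Poly_Mapping.lookup f \<rho> \<noteq> 0" by (rule lookup_single_mult_nz)
  then have "\<not> wlt w \<omega> \<rho> \<nu>" using assms by (simp add: o.is_lead_def)
  then show "\<not> wlt w \<omega> \<xi> (\<mu> + \<nu>)" unfolding \<rho>(1) by (simp add: wlt_def)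
qed

context generic_weight
begin

text \<open>The exponent set of the initial monomial ideal for the order
  \<open>wlt w \<omega>\<close>. Only forms are used, so that each degree is a finite problem
  although the order need not be a well-order.\<close>

definition lead_monomials :: "real^'n \<Rightarrow> ('n, 'k::field) mpoly set \<Rightarrow> ('n \<Rightarrow>\<^sub>0 nat) set" where
  "lead_monomials \<omega> J = (\<Union>d. o.leads \<omega> (J \<inter> forms d))"

lemma leads_forms: "o.leads \<omega> (J \<inter> forms d) \<subseteq> mons d"
  by (rule o.leads_subset) simp

lemma lead_monomials_Int_mons: "lead_monomials \<omega> J \<inter> mons d = o.leads \<omega> (J \<inter> forms d)"
proof -
  have "d = e" if "\<nu> \<in> o.leads \<omega> (J \<inter> forms e)" "\<nu> \<in> mons d" for \<nu> e
    using leads_forms[of \<omega> J e] that by (auto simp: mons_def)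
  then show ?thesis using leads_forms[of \<omega> J d] by (auto simp: lead_monomials_def)
qed

lemma finite_leads_forms: "finite (o.leads \<omega> (J \<inter> forms d))"
  by (rule finite_subset[OF leads_forms]) simp

lemma piv_leads_forms: "is_ideal J \<Longrightarrow> piv (J \<inter> forms d) (o.leads \<omega> (J \<inter> forms d))"
  by (intro o.piv_leads subspace_form_part finite_leads_forms)

lemma card_lead_monomials: "is_ideal J \<Longrightarrow> card (lead_monomials \<omega> J \<inter> mons d) = mp.dim (J \<inter> forms d)"
  unfolding lead_monomials_Int_mons by (rule piv_dim[symmetric]) (simp_all add: subspace_form_part piv_leads_forms)

lemma upset_lead_monomials:
  assumes "is_ideal J"
  shows "upset (lead_monomials \<omega> J)"
  unfolding upset_def
proof (intro ballI allI)
  fix \<nu> \<mu> assume "\<nu> \<in> lead_monomials \<omega> J"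
  then obtain d f where f: "f \<in> J" "f \<in> forms d" "o.is_lead \<omega> f \<nu>"
    by (auto simp: lead_monomials_def o.leads_def)
  let ?g = "Poly_Mapping.single \<mu> 1 * f"
  have "?g \<in> J \<inter> forms (d + total_deg \<mu>)" using f assms by (intro IntI ideal_mult single_mult_forms)
  moreover have "o.is_lead \<omega> ?g (\<nu> + \<mu>)" using is_lead_shift[OF f(3), of \<mu>] by (simp add: add.commute)
  ultimately show "\<nu> + \<mu> \<in> lead_monomials \<omega> J"
    unfolding lead_monomials_def o.leads_def by blast
qed

end

text \<open>The weight bound \<open>a\<close> is there for the division by a variable, where the
  weight is an exponent; with \<omega> = 0 and \<open>a\<close> = 0 it is void, and the span
  expresses plain generation in degrees at most \<open>D\<close>.\<close>

definition low_multiples :: "real^'n \<Rightarrow> nat \<Rightarrow> ('n::finite, 'k::field) mpoly set \<Rightarrow> nat \<Rightarrow> real \<Rightarrow> ('n, 'k) mpoly set" where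
  "low_multiples \<omega> D J d a = {Poly_Mapping.single \<mu> 1 * p | \<mu> p. (\<exists>e\<le>D. p \<in> J \<inter> forms e) \<and>
     Poly_Mapping.single \<mu> 1 * p \<in> forms d \<and>
     (\<forall>\<xi>. Poly_Mapping.lookup (Poly_Mapping.single \<mu> 1 * p) \<xi> \<noteq> 0 \<longrightarrow> a \<le> wdeg \<omega> \<xi>)}"

text \<open>Both spaces have the same leading monomials.\<close>
lemma (in generic_weight) span_low_multiples:
  fixes J :: "('n, 'k::field) mpoly set"
  assumes J: "is_ideal J" and gen: "gen_upto D (lead_monomials \<omega> J)"
  shows "mp.span (low_multiples \<omega> D J d a) =
    {h \<in> J \<inter> forms d. \<forall>\<xi>. Poly_Mapping.lookup h \<xi> \<noteq> 0 \<longrightarrow> a \<le> wdeg \<omega> \<xi>}" (is "?T = ?H")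
proof -
  have H: "?H = (J \<inter> forms d) \<inter> supported {\<xi>. a \<le> wdeg \<omega> \<xi>}" by (auto simp: supported_def)
  have subH: "mp.subspace ?H" unfolding H
    by (intro mp.subspace_inter subspace_form_part J subspace_supported)
  have TH: "?T \<subseteq> ?H"
    using J by (intro mp.span_minimal subH) (auto simp: low_multiples_def intro: ideal_mult)
  have subT: "mp.subspace ?T" by simp
  have fin: "finite (o.leads \<omega> ?H)"
    by (rule finite_subset[OF o.leads_subset[of ?H "mons d"]]) auto
  have LT: "o.leads \<omega> ?T \<subseteq> o.leads \<omega> ?H" using TH unfolding o.leads_def by blast
  have "o.leads \<omega> ?H \<subseteq> o.leads \<omega> ?T"
  proof
    fix \<nu> assume "\<nu> \<in> o.leads \<omega> ?H"
    then obtain h where h: "h \<in> ?H" "o.is_lead \<omega> h \<nu>" by (auto simp: o.leads_def)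
    have hn: "Poly_Mapping.lookup h \<nu> \<noteq> 0" using h(2) by (simp add: o.is_lead_def)
    then have a: "a \<le> wdeg \<omega> \<nu>" and d: "total_deg \<nu> = d" using h(1) by (auto simp: mem_forms)
    have "\<nu> \<in> lead_monomials \<omega> J" using h unfolding lead_monomials_def o.leads_def by blast
    then obtain \<kappa> \<mu> where \<kappa>: "\<kappa> \<in> lead_monomials \<omega> J" "\<nu> = \<kappa> + \<mu>" "total_deg \<kappa> \<le> D"
      using gen unfolding gen_upto_def by blast
    then have "\<kappa> \<in> o.leads \<omega> (J \<inter> forms (total_deg \<kappa>))"
      using lead_monomials_Int_mons[of \<omega> J "total_deg \<kappa>"] by (auto simp: mons_def)
    then obtain p where p: "p \<in> J \<inter> forms (total_deg \<kappa>)" "o.is_lead \<omega> p \<kappa>" by (auto simp: o.leads_def)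
    let ?g = "Poly_Mapping.single \<mu> 1 * p"
    have lead: "o.is_lead \<omega> ?g \<nu>" using is_lead_shift[OF p(2), of \<mu>] \<kappa>(2) by (simp add: add.commute)
    have "?g \<in> forms (total_deg \<kappa> + total_deg \<mu>)" using p by (intro single_mult_forms) simp
    then have "?g \<in> forms d" using d \<kappa>(2) by simp
    \<comment> \<open>A leading exponent has minimal weight, so the bound at \<nu>, inherited from
      \<open>h\<close>, extends to all terms of \<open>?g\<close>.\<close>
    moreover have "a \<le> wdeg \<omega> \<xi>" if "Poly_Mapping.lookup ?g \<xi> \<noteq> 0" for \<xi>
    proof -
      have "\<not> wlt w \<omega> \<xi> \<nu>" using lead that by (simp add: o.is_lead_def)
      then show ?thesis using a by (simp add: wlt_def)
    qed
    ultimately have "?g \<in> low_multiples \<omega> D J d a"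
      using p(1) \<kappa>(3) unfolding low_multiples_def by blast
    then have "?g \<in> ?T" by (rule mp.span_base)
    then show "\<nu> \<in> o.leads \<omega> ?T" using lead unfolding o.leads_def by blast
  qed
  then have L: "o.leads \<omega> ?T = o.leads \<omega> ?H" using LT by blast
  have "finite (o.leads \<omega> ?T)" unfolding L by (rule fin)
  then have "piv ?T (o.leads \<omega> ?T)" by (rule o.piv_leads[OF subT])
  then show ?thesis
    by (rule piv_subset_eq[OF subT subH TH _ o.piv_leads[OF subH fin] arg_cong[OF L, of card]])
qed

lemma wdeg_axis: "wdeg (axis i 1) \<nu> = real (Poly_Mapping.lookup \<nu> i)"
proof -
  have "wdeg (axis i 1) \<nu> = (\<Sum>j\<in>UNIV. if j = i then real (Poly_Mapping.lookup \<nu> i) else 0)"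
    unfolding wdeg_def by (intro sum.cong) (auto simp: axis_def)
  then show ?thesis by simp
qed

lemma single_mult_cancel:
  fixes \<mu> :: "'a::cancel_comm_monoid_add" and f g :: "'a \<Rightarrow>\<^sub>0 'k::comm_semiring_1"
  assumes "Poly_Mapping.single \<mu> 1 * f = Poly_Mapping.single \<mu> 1 * g"
  shows "f = g"
proof (rule poly_mapping_eqI)
  fix \<nu> show "Poly_Mapping.lookup f \<nu> = Poly_Mapping.lookup g \<nu>"
    using lookup_single_mult[of \<mu> 1 f \<nu>] lookup_single_mult[of \<mu> 1 g \<nu>] assms by simp
qed

lemma lookup_le_total_deg: "Poly_Mapping.lookup \<nu> i \<le> total_deg \<nu>"
  unfolding total_deg_def by (intro member_le_sum) auto

text \<open>For the order refining the exponent of \<open>x\<^sub>i\<close>, a leading term divisible by \<open>x\<^sub>i\<close> comes from a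
  polynomial divisible by \<open>x\<^sub>i\<close>, as for the reverse lexicographic order.\<close>
lemma (in generic_weight) divide_variable:
  fixes J :: "('n, 'k::field) mpoly set"
  assumes J: "is_ideal J" and gen: "gen_upto D (lead_monomials (axis i 1) J)"
    and m: "Poly_Mapping.single (Poly_Mapping.single i 1 + \<nu>) 1 \<in> J"
    and D: "D < Suc (Poly_Mapping.lookup \<nu> i)"
  shows "Poly_Mapping.single \<nu> 1 \<in> J"
proof -
  let ?x = "Poly_Mapping.single i 1 :: 'n \<Rightarrow>\<^sub>0 nat"
  let ?X = "Poly_Mapping.single ?x 1 :: ('n, 'k) mpoly"
  \<comment> \<open>The exponent of \<open>x\<^sub>i\<close> in \<open>?m\<close>, which is its
    weight by \<open>wdeg_axis\<close>. It exceeds \<open>D\<close>, hence the degree of every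
    generator involved.\<close>
  let ?a = "real (Suc (Poly_Mapping.lookup \<nu> i))"
  let ?m = "Poly_Mapping.single (?x + \<nu>) 1 :: ('n, 'k) mpoly"
  have "?m \<in> forms (total_deg (?x + \<nu>))"
    by (auto simp: mem_forms lookup_single when_def split: if_splits)
  moreover have "?a \<le> wdeg (axis i 1) \<xi>" if "Poly_Mapping.lookup ?m \<xi> \<noteq> 0" for \<xi>
    using that by (auto simp: lookup_single when_def wdeg_axis lookup_add split: if_splits)
  ultimately have "?m \<in> mp.span (low_multiples (axis i 1) D J (total_deg (?x + \<nu>)) ?a)"
    unfolding span_low_multiples[OF J gen] using m by blast
  moreover have "mp.span (low_multiples (axis i 1) D J (total_deg (?x + \<nu>)) ?a) \<subseteq> {?X * q | q. q \<in> J}"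
  proof (rule mp.span_minimal)
    show "mp.subspace {?X * q | q. q \<in> J}"
    proof (rule mp.subspaceI)
      show "0 \<in> {?X * q | q. q \<in> J}" using ideal_0[OF J] by force
      fix u v c assume "u \<in> {?X * q | q. q \<in> J}"
      then obtain q where q: "u = ?X * q" "q \<in> J" by blast
      have "cmul c u = ?X * cmul c q" unfolding q by (simp add: cmul_def mult.left_commute)
      then show "cmul c u \<in> {?X * q | q. q \<in> J}"
        using mp.subspace_scale[OF subspace_ideal[OF J] q(2)] by blast
      assume "v \<in> {?X * q | q. q \<in> J}"
      then obtain r where r: "v = ?X * r" "r \<in> J" by blast
      have "u + v = ?X * (q + r)" unfolding q r by (simp add: distrib_left)
      then show "u + v \<in> {?X * q | q. q \<in> J}" using ideal_add[OF J q(2) r(2)] by blast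
    qed
    show "low_multiples (axis i 1) D J (total_deg (?x + \<nu>)) ?a \<subseteq> {?X * q | q. q \<in> J}"
    proof
      fix g assume "g \<in> low_multiples (axis i 1) D J (total_deg (?x + \<nu>)) ?a"
      then obtain \<mu> p e where g: "g = Poly_Mapping.single \<mu> 1 * p" "e \<le> D" "p \<in> J" "p \<in> forms e"
        "\<And>\<xi>. Poly_Mapping.lookup g \<xi> \<noteq> 0 \<Longrightarrow> ?a \<le> wdeg (axis i 1) \<xi>"
        unfolding low_multiples_def by blast
      show "g \<in> {?X * q | q. q \<in> J}"
      proof (cases "Poly_Mapping.lookup \<mu> i = 0")
        \<comment> \<open>If \<mu> lacks \<open>x\<^sub>i\<close>, every term of \<open>p\<close>
          must itself contain \<open>x\<^sub>i\<close> at least \<open>?a\<close> times, more than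
          its degree allows; so \<open>p\<close> is 0.\<close>
        case True
        have "Poly_Mapping.lookup p \<rho> = 0" for \<rho>
        proof (rule ccontr)
          assume nz: "Poly_Mapping.lookup p \<rho> \<noteq> 0"
          then have "Poly_Mapping.lookup g (\<mu> + \<rho>) \<noteq> 0" by (simp add: g(1) lookup_single_mult)
          then have "?a \<le> wdeg (axis i 1) (\<mu> + \<rho>)" by (rule g(5))
          then have "Suc (Poly_Mapping.lookup \<nu> i) \<le> Poly_Mapping.lookup \<rho> i"
            unfolding wdeg_axis of_nat_le_iff by (simp only: lookup_add True add_0)
          moreover have "total_deg \<rho> \<le> D" using nz g(2,4) by (auto simp: mem_forms)
          ultimately show False using lookup_le_total_deg[of \<rho> i] D by simp
        qed
        then have "p = 0" by (intro poly_mapping_eqI) simp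
        then have "g = ?X * 0" using g(1) by simp
        then show ?thesis using ideal_0[OF J] by blast
      next
        case False
        then have "\<mu> = ?x + (\<mu> - ?x)"
          by (intro poly_mapping_eqI) (auto simp: lookup_add lookup_minus lookup_single when_def)
        then have "g = ?X * (Poly_Mapping.single (\<mu> - ?x) 1 * p)"
          unfolding g(1) mult.assoc[symmetric] mult_single by simp
        then show ?thesis using ideal_mult[OF J g(3)] by blast
      qed
    qed
  qed
  ultimately obtain q where q: "?m = ?X * q" "q \<in> J" by blast
  have "?m = ?X * Poly_Mapping.single \<nu> 1" by (simp add: mult_single)
  with q(1) have "?X * q = ?X * Poly_Mapping.single \<nu> 1" by (rule subst)
  then have "q = Poly_Mapping.single \<nu> 1" by (rule single_mult_cancel)
  then show ?thesis using q(2) by simp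
qed

text \<open>As long as some exponent exceeds \<open>D\<close>, \<open>divide_variable\<close> lowers
  it by one without leaving \<open>J\<close>. Once all exponents are at most \<open>D\<close>, their
  sum is at most \<open>CARD('n) * D\<close>.\<close>

lemma (in generic_weight) monomial_low_degree:
  fixes J :: "('n, 'k::field) mpoly set"
  assumes J: "is_ideal J" and gen: "\<And>i. gen_upto D (lead_monomials (axis i 1) J)"
    and "Poly_Mapping.single \<nu> 1 \<in> J"
  shows "\<exists>\<mu>. Poly_Mapping.single \<mu> 1 \<in> J \<and> total_deg \<mu> \<le> CARD('n) * D"
  using assms(3)
proof (induction "total_deg \<nu>" arbitrary: \<nu> rule: less_induct)
  case less
  show ?case
  proof (cases "\<exists>i. D < Poly_Mapping.lookup \<nu> i")
    case True
    then obtain i where i: "D < Poly_Mapping.lookup \<nu> i" by blast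
    let ?x = "Poly_Mapping.single i 1 :: 'n \<Rightarrow>\<^sub>0 nat"
    have e: "\<nu> = ?x + (\<nu> - ?x)"
      using i by (intro poly_mapping_eqI) (auto simp: lookup_add lookup_minus lookup_single when_def)
    have "Poly_Mapping.single (\<nu> - ?x) 1 \<in> J"
    proof (rule divide_variable[OF J gen])
      show "Poly_Mapping.single (?x + (\<nu> - ?x)) 1 \<in> J" using less.prems e by simp
      show "D < Suc (Poly_Mapping.lookup (\<nu> - ?x) i)" using i by (simp add: lookup_minus)
    qed
    moreover have "total_deg \<nu> = total_deg ?x + total_deg (\<nu> - ?x)" by (subst e) simp
    moreover have "1 \<le> total_deg ?x" using lookup_le_total_deg[of ?x i] by simp
    ultimately show ?thesis using less.hyps[of "\<nu> - ?x"] by simp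
  next
    case False
    then have "total_deg \<nu> \<le> CARD('n) * D"
      unfolding total_deg_def using sum_bounded_above[of UNIV "Poly_Mapping.lookup \<nu>" D] by (simp add: not_less)
    then show ?thesis using less.prems by blast
  qed
qed

text \<open>\<open>D\<close> is chosen from \<open>r\<close> alone, before any ideal, so one value
  serves the initial ideals of all g(I) for all weights. The larger of the generator bound and the
  monomial bound is used for both claims.\<close>

lemma bounded_degree:
  fixes r :: "nat \<Rightarrow> nat"
  obtains D where
    "\<And>(J :: ('n::finite, 'k::field) mpoly set) (K :: ('n, 'k) mpoly set). graded_ideal J \<Longrightarrow> graded_ideal K \<Longrightarrow>
      (\<And>d. mp.dim (J \<inter> forms d) = r d) \<Longrightarrow> (\<And>d. mp.dim (K \<inter> forms d) = r d) \<Longrightarrow>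
      (\<And>d. d \<le> D \<Longrightarrow> J \<inter> forms d = K \<inter> forms d) \<Longrightarrow> J = K"
    "\<And>J :: ('n, 'k) mpoly set. graded_ideal J \<Longrightarrow> (\<And>d. mp.dim (J \<inter> forms d) = r d) \<Longrightarrow>
      (\<exists>m\<in>J. is_monomial m) \<Longrightarrow> \<exists>\<mu>. Poly_Mapping.single \<mu> 1 \<in> J \<and> total_deg \<mu> \<le> D"
proof -
  obtain w :: "real^'n" where "inj (wdeg w :: ('n \<Rightarrow>\<^sub>0 nat) \<Rightarrow> real)" using generic_weight_exists by blast
  then interpret generic_weight w by unfold_locales
  obtain D where D: "\<And>N :: ('n \<Rightarrow>\<^sub>0 nat) set. upset N \<Longrightarrow> (\<And>d. card (N \<inter> mons d) = r d) \<Longrightarrow> gen_upto D N"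
    using gen_upto_of_hilbert_function[of r] by blast
  have gen: "gen_upto D (lead_monomials \<omega> J)"
    if "graded_ideal J" "\<And>d. mp.dim (J \<inter> forms d) = r d" for J :: "('n, 'k) mpoly set" and \<omega>
    using that by (intro D upset_lead_monomials) (simp_all add: graded_ideal_is_ideal card_lead_monomials)
  let ?D = "max D (CARD('n) * D)"
  show ?thesis
  proof (rule that[of ?D])
    fix J K :: "('n, 'k) mpoly set"
    assume g: "graded_ideal J" "graded_ideal K"
      and J: "\<And>d. mp.dim (J \<inter> forms d) = r d" and K: "\<And>d. mp.dim (K \<inter> forms d) = r d"
      and eq: "\<And>d. d \<le> ?D \<Longrightarrow> J \<inter> forms d = K \<inter> forms d"
    \<comment> \<open>Weight 0 with bound 0 imposes nothing, so a degree \<open>d\<close> part is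
      spanned by multiples of the parts in degrees at most \<open>D\<close>.\<close>
    have span: "A \<inter> forms d = mp.span (low_multiples 0 D A d 0)"
      if "graded_ideal A" "\<And>d. mp.dim (A \<inter> forms d) = r d" for A :: "('n, 'k) mpoly set" and d
      using span_low_multiples[OF graded_ideal_is_ideal[OF that(1)] gen[OF that], of 0 d 0]
      by (auto simp: wdeg_def)
    have low: "low_multiples 0 D J d 0 = low_multiples 0 D K d 0" for d
    proof -
      have "J \<inter> forms e = K \<inter> forms e" if "e \<le> D" for e
        by (intro eq order_trans[OF that max.cobounded1])
      then have "(\<exists>e\<le>D. p \<in> J \<inter> forms e) \<longleftrightarrow> (\<exists>e\<le>D. p \<in> K \<inter> forms e)" for p
        by (intro ex_cong1 conj_cong refl) (simp only:)
      then show ?thesis unfolding low_multiples_def by simp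
    qed
    have "J \<inter> forms d = K \<inter> forms d" for d
      unfolding span[OF g(1) J] span[OF g(2) K] low ..
    then show "J = K" by (rule graded_ideal_eqI[OF g])
  next
    fix J :: "('n, 'k) mpoly set"
    assume g: "graded_ideal J" and J: "\<And>d. mp.dim (J \<inter> forms d) = r d" and "\<exists>m\<in>J. is_monomial m"
    then obtain \<nu> c where c: "c \<noteq> 0" "Poly_Mapping.single \<nu> c \<in> J" by (auto simp: is_monomial_def)
    have "Poly_Mapping.single 0 (inverse c) * Poly_Mapping.single \<nu> c \<in> J"
      using c g by (intro ideal_mult graded_ideal_is_ideal)
    then have "Poly_Mapping.single \<nu> 1 \<in> J" using c by (simp add: mult_single)
    from monomial_low_degree[OF graded_ideal_is_ideal[OF g] gen[OF g J] this]
    show "\<exists>\<mu>. Poly_Mapping.single \<mu> 1 \<in> J \<and> total_deg \<mu> \<le> ?D" by auto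
  qed
qed

text \<open>The cones and the absence of monomials are reduced to the initial subspaces in degrees
  at most \<open>D\<close>, where \<open>inV_eq_iff\<close> and \<open>monomial_in_inV_iff\<close>
  leave only pivot sets. The bounds apply because initial ideals keep the Hilbert function
  \<open>r\<close>.\<close>

lemma trop_fan_cong:
  fixes r :: "nat \<Rightarrow> nat"
  obtains D where
    "\<And>(J :: ('n::finite, 'k::field) mpoly set) (K :: ('n, 'k) mpoly set). graded_ideal J \<Longrightarrow> graded_ideal K \<Longrightarrow>
      (\<And>d. mp.dim (J \<inter> forms d) = r d) \<Longrightarrow> (\<And>d. mp.dim (K \<inter> forms d) = r d) \<Longrightarrow>
      (\<And>d S. d \<le> D \<Longrightarrow> piv (J \<inter> forms d) S \<longleftrightarrow> piv (K \<inter> forms d) S) \<Longrightarrow> trop_fan J = trop_fan K"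
proof -
  obtain D where D1: "\<And>(J :: ('n::finite, 'k::field) mpoly set) (K :: ('n, 'k) mpoly set). graded_ideal J \<Longrightarrow> graded_ideal K \<Longrightarrow>
      (\<And>d. mp.dim (J \<inter> forms d) = r d) \<Longrightarrow> (\<And>d. mp.dim (K \<inter> forms d) = r d) \<Longrightarrow>
      (\<And>d. d \<le> D \<Longrightarrow> J \<inter> forms d = K \<inter> forms d) \<Longrightarrow> J = K"
    and D2: "\<And>J :: ('n, 'k) mpoly set. graded_ideal J \<Longrightarrow> (\<And>d. mp.dim (J \<inter> forms d) = r d) \<Longrightarrow>
      (\<exists>m\<in>J. is_monomial m) \<Longrightarrow> \<exists>\<mu>. Poly_Mapping.single \<mu> 1 \<in> J \<and> total_deg \<mu> \<le> D"
    using bounded_degree[of r] by blast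
  show ?thesis
  proof (rule that[of D])
    fix J K :: "('n, 'k) mpoly set"
    assume g: "graded_ideal J" "graded_ideal K"
      and J: "\<And>d. mp.dim (J \<inter> forms d) = r d" and K: "\<And>d. mp.dim (K \<inter> forms d) = r d"
      and piv: "\<And>d S. d \<le> D \<Longrightarrow> piv (J \<inter> forms d) S \<longleftrightarrow> piv (K \<inter> forms d) S"
    have dim: "mp.dim (init_ideal \<omega> A \<inter> forms d) = r d"
      if "graded_ideal A" "\<And>d. mp.dim (A \<inter> forms d) = r d" for A :: "('n, 'k) mpoly set" and \<omega> d
      unfolding init_ideal_forms[OF that(1)]
      by (subst dim_inV[OF subspace_form_part[OF graded_ideal_is_ideal[OF that(1)]] finite_mons[of d]]) (use that in auto)
    \<comment> \<open>\<open>D1\<close> is applied to two initial ideals of the same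
      \<open>A\<close>; the ideals \<open>J\<close> and \<open>K\<close> meet only through their
      pivot sets.\<close>
    have eq: "init_ideal \<omega> A = init_ideal \<omega>' A \<longleftrightarrow> (\<forall>d\<le>D. inV \<omega> (A \<inter> forms d) = inV \<omega>' (A \<inter> forms d))"
      if A: "graded_ideal A" "\<And>d. mp.dim (A \<inter> forms d) = r d" for A :: "('n, 'k) mpoly set" and \<omega> \<omega>'
      using D1[OF graded_init_ideal[OF A(1)] graded_init_ideal[OF A(1)] dim[OF A] dim[OF A], of \<omega> \<omega>']
      by (auto simp: init_ideal_forms[OF A(1), symmetric])
    have mon: "(\<exists>m\<in>init_ideal \<omega> A. is_monomial m) \<longleftrightarrow>
        (\<exists>\<mu>. total_deg \<mu> \<le> D \<and> Poly_Mapping.single \<mu> 1 \<in> inV \<omega> (A \<inter> forms (total_deg \<mu>)))"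
      if A: "graded_ideal A" "\<And>d. mp.dim (A \<inter> forms d) = r d" for A :: "('n, 'k) mpoly set" and \<omega>
    proof -
      have f: "Poly_Mapping.single \<mu> (1 :: 'k) \<in> forms (total_deg \<mu>)" for \<mu> :: "'n \<Rightarrow>\<^sub>0 nat"
        by (auto simp: mem_forms lookup_single when_def split: if_splits)
      have "(\<exists>m\<in>init_ideal \<omega> A. is_monomial m) \<longleftrightarrow>
          (\<exists>\<mu>. total_deg \<mu> \<le> D \<and> Poly_Mapping.single \<mu> 1 \<in> init_ideal \<omega> A)"
      proof
        assume "\<exists>m\<in>init_ideal \<omega> A. is_monomial m"
        from D2[OF graded_init_ideal[OF A(1)] dim[OF A] this]
        show "\<exists>\<mu>. total_deg \<mu> \<le> D \<and> Poly_Mapping.single \<mu> 1 \<in> init_ideal \<omega> A" by blast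
      next
        assume "\<exists>\<mu>. total_deg \<mu> \<le> D \<and> Poly_Mapping.single \<mu> 1 \<in> init_ideal \<omega> A"
        then obtain \<mu> where "Poly_Mapping.single \<mu> 1 \<in> init_ideal \<omega> A" by blast
        moreover have "is_monomial (Poly_Mapping.single \<mu> (1 :: 'k))"
          unfolding is_monomial_def using one_neq_zero by blast
        ultimately show "\<exists>m\<in>init_ideal \<omega> A. is_monomial m" by blast
      qed
      then show ?thesis using f by (simp add: init_ideal_forms[OF A(1), symmetric])
    qed
    have sub: "mp.subspace (A \<inter> forms d)" if "graded_ideal A" for A :: "('n, 'k) mpoly set" and d
      by (intro subspace_form_part graded_ideal_is_ideal that)
    have "inV \<omega> (J \<inter> forms d) = inV \<omega>' (J \<inter> forms d) \<longleftrightarrow> inV \<omega> (K \<inter> forms d) = inV \<omega>' (K \<inter> forms d)"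
      if "d \<le> D" for \<omega> \<omega>' d
      unfolding inV_eq_iff[OF sub[OF g(1)] finite_mons Int_lower2] inV_eq_iff[OF sub[OF g(2)] finite_mons Int_lower2]
        piv[OF that] ..
    then have "groebner_cone J = groebner_cone K"
      unfolding groebner_cone_def fun_eq_iff eq[OF g(1) J] eq[OF g(2) K] by simp
    moreover have "Poly_Mapping.single \<mu> 1 \<in> inV \<omega> (J \<inter> forms (total_deg \<mu>)) \<longleftrightarrow>
        Poly_Mapping.single \<mu> 1 \<in> inV \<omega> (K \<inter> forms (total_deg \<mu>))" if "total_deg \<mu> \<le> D" for \<omega> \<mu>
      unfolding monomial_in_inV_iff[OF sub[OF g(1)] finite_mons Int_lower2]
        monomial_in_inV_iff[OF sub[OF g(2)] finite_mons Int_lower2] piv[OF that] ..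
    then have "(\<exists>m\<in>init_ideal \<omega> J. is_monomial m) \<longleftrightarrow> (\<exists>m\<in>init_ideal \<omega> K. is_monomial m)" for \<omega>
      unfolding mon[OF g(1) J] mon[OF g(2) K] by blast
    ultimately show "trop_fan J = trop_fan K" unfolding trop_fan_def by simp
  qed
qed

subsection \<open>Linear substitutions\<close>

definition monom_eval :: "('n::finite \<Rightarrow> 'r::comm_ring_1) \<Rightarrow> ('n \<Rightarrow>\<^sub>0 nat) \<Rightarrow> 'r" where
  "monom_eval \<phi> \<nu> = (\<Prod>i\<in>UNIV. \<phi> i ^ Poly_Mapping.lookup \<nu> i)"

lemma monom_eval_0 [simp]: "monom_eval \<phi> 0 = 1"
  by (simp add: monom_eval_def)

lemma monom_eval_add: "monom_eval \<phi> (\<nu> + \<mu>) = monom_eval \<phi> \<nu> * monom_eval \<phi> \<mu>"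
  by (simp add: monom_eval_def lookup_add power_add prod.distrib)

lemma monom_eval_var: "monom_eval \<phi> (Poly_Mapping.single i 1) = \<phi> i"
proof -
  have "monom_eval \<phi> (Poly_Mapping.single i 1) = (\<Prod>j\<in>UNIV. if j = i then \<phi> j else 1)"
    unfolding monom_eval_def by (intro prod.cong) (auto simp: lookup_single when_def)
  then show ?thesis by simp
qed

text \<open>Evaluation homomorphisms with coefficients mapped by \<open>c\<close>. The two instances
  are substitution of linear forms (\<open>lin_subst\<close>) and evaluation at the entries of a
  matrix (\<open>mpeval\<close>).\<close>

locale poly_eval =
  fixes c :: "'k::comm_ring_1 \<Rightarrow> 'r::comm_ring_1" and \<phi> :: "'n::finite \<Rightarrow> 'r"
  assumes c0: "c 0 = 0" and c1: "c 1 = 1"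
    and c_add: "c (a + b) = c a + c b" and c_mult: "c (a * b) = c a * c b"
begin

definition ev :: "('n, 'k) mpoly \<Rightarrow> 'r" where
  "ev f = (\<Sum>\<nu>\<in>Poly_Mapping.keys f. c (Poly_Mapping.lookup f \<nu>) * monom_eval \<phi> \<nu>)"

lemma ev_superset:
  assumes "finite A" "Poly_Mapping.keys f \<subseteq> A"
  shows "ev f = (\<Sum>\<nu>\<in>A. c (Poly_Mapping.lookup f \<nu>) * monom_eval \<phi> \<nu>)"
  unfolding ev_def using assms by (intro sum.mono_neutral_left) (auto simp: in_keys_iff c0)

lemma ev_0: "ev 0 = 0"
  by (simp add: ev_def)

lemma ev_single: "ev (Poly_Mapping.single \<nu> a) = c a * monom_eval \<phi> \<nu>"
  by (subst ev_superset[of "{\<nu>}"]) (auto simp: c0 lookup_single)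

lemma ev_add: "ev (f + g) = ev f + ev g"
proof -
  let ?A = "Poly_Mapping.keys f \<union> Poly_Mapping.keys g"
  have "finite ?A" "Poly_Mapping.keys (f + g) \<subseteq> ?A" using keys_add[of f g] by auto
  then show ?thesis
    by (simp add: ev_superset[of ?A] lookup_add c_add distrib_right sum.distrib)
qed

lemma ev_sum: "ev (sum F A) = (\<Sum>x\<in>A. ev (F x))"
  by (induction A rule: infinite_finite_induct) (simp_all add: ev_0 ev_add)

lemma ev_mult: "ev (f * g) = ev f * ev g"
proof -
  let ?l = Poly_Mapping.lookup and ?K = Poly_Mapping.keys and ?s = Poly_Mapping.single
  have "f * g = (\<Sum>\<nu>\<in>?K f. ?s \<nu> (?l f \<nu>)) * (\<Sum>\<mu>\<in>?K g. ?s \<mu> (?l g \<mu>))" by (simp add: sum_singles)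
  also have "\<dots> = (\<Sum>\<nu>\<in>?K f. \<Sum>\<mu>\<in>?K g. ?s (\<nu> + \<mu>) (?l f \<nu> * ?l g \<mu>))"
    by (simp add: sum_product mult_single)
  finally have "ev (f * g) = (\<Sum>\<nu>\<in>?K f. \<Sum>\<mu>\<in>?K g. c (?l f \<nu> * ?l g \<mu>) * monom_eval \<phi> (\<nu> + \<mu>))"
    by (simp only: ev_sum ev_single)
  also have "\<dots> = (\<Sum>\<nu>\<in>?K f. \<Sum>\<mu>\<in>?K g. (c (?l f \<nu>) * monom_eval \<phi> \<nu>) * (c (?l g \<mu>) * monom_eval \<phi> \<mu>))"
    by (intro sum.cong refl) (simp add: c_mult monom_eval_add mult_ac)
  also have "\<dots> = ev f * ev g" by (simp add: ev_def sum_product)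
  finally show ?thesis .
qed

lemma ev_const: "ev (Poly_Mapping.single 0 a) = c a"
  by (simp add: ev_single)

lemma ev_1: "ev 1 = 1"
  using ev_const[of 1] by (simp add: c1)

lemma ev_prod: "ev (prod F A) = (\<Prod>x\<in>A. ev (F x))"
  by (induction A rule: infinite_finite_induct) (simp_all add: ev_1 ev_mult)

lemma ev_power: "ev (f ^ n) = ev f ^ n"
  by (induction n) (simp_all add: ev_1 ev_mult)

lemma ev_Var: "ev (Var i) = \<phi> i"
  by (simp add: Var_def ev_single c1 monom_eval_var[simplified])

end

definition linear_form :: "'k^'n^'n \<Rightarrow> 'n::finite \<Rightarrow> ('n, 'k::comm_ring_1) mpoly" where
  "linear_form g i = (\<Sum>j\<in>UNIV. Poly_Mapping.single 0 (g $ i $ j) * Var j)"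

interpretation subst: poly_eval "Poly_Mapping.single 0" "linear_form g"
  for g :: "'k::comm_ring_1^'n::finite^'n"
  by unfold_locales (simp_all add: single_add mult_single)

lemma lin_subst_eq: "lin_subst g = subst.ev g"
  by (rule ext) (simp add: lin_subst_def subst.ev_def monom_eval_def linear_form_def)

interpretation entries: poly_eval "\<lambda>x. x" "\<lambda>ij. g $ fst ij $ snd ij"
  for g :: "'k::comm_ring_1^'n::finite^'n"
  by unfold_locales simp_all

lemma mpeval_eq: "mpeval p g = entries.ev g p"
  by (simp add: mpeval_def entries.ev_def monom_eval_def)

lemma single_sum: "Poly_Mapping.single k (sum F A) = (\<Sum>x\<in>A. Poly_Mapping.single k (F x))"
  by (induction A rule: infinite_finite_induct) (simp_all add: single_add)

lemma linear_form_mult: "subst.ev A (linear_form B i) = linear_form (B ** A) i"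
proof -
  have "subst.ev A (linear_form B i) =
      (\<Sum>j\<in>UNIV. \<Sum>k\<in>UNIV. Poly_Mapping.single 0 (B $ i $ j) * (Poly_Mapping.single 0 (A $ j $ k) * Var k))"
    unfolding linear_form_def[of B] subst.ev_sum subst.ev_mult subst.ev_const subst.ev_Var
    by (simp add: linear_form_def sum_distrib_left)
  also have "\<dots> = (\<Sum>j\<in>UNIV. \<Sum>k\<in>UNIV. Poly_Mapping.single 0 (B $ i $ j * A $ j $ k) * Var k)"
    by (simp add: mult.assoc[symmetric] mult_single)
  also have "\<dots> = (\<Sum>k\<in>UNIV. \<Sum>j\<in>UNIV. Poly_Mapping.single 0 (B $ i $ j * A $ j $ k) * Var k)"
    by (rule sum.swap)
  also have "\<dots> = linear_form (B ** A) i"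
  proof -
    show ?thesis unfolding linear_form_def matrix_matrix_mult_def by (simp only: vec_lambda_beta single_sum sum_distrib_right)
  qed
  finally show ?thesis .
qed

text \<open>Substitution reverses products: the inner substitution writes variables through rows of
  \<open>B\<close>, and the outer one expands these rows by \<open>A\<close>.\<close>

lemma lin_subst_lin_subst: "lin_subst A (lin_subst B f) = lin_subst (B ** A) f"
proof -
  have "subst.ev A (subst.ev B f) =
      (\<Sum>\<nu>\<in>Poly_Mapping.keys f. Poly_Mapping.single 0 (Poly_Mapping.lookup f \<nu>) * monom_eval (linear_form (B ** A)) \<nu>)"
    unfolding subst.ev_def[of B] subst.ev_sum subst.ev_mult subst.ev_const
    by (simp add: monom_eval_def subst.ev_prod subst.ev_power linear_form_mult)
  then show ?thesis by (simp add: lin_subst_eq subst.ev_def)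
qed

lemma Var_power: "(Var i :: ('n, 'k::comm_ring_1) mpoly) ^ n = Poly_Mapping.single (Poly_Mapping.single i n) 1"
proof (induction n)
  case (Suc n)
  have e: "Poly_Mapping.single i (Suc n) = Poly_Mapping.single i 1 + Poly_Mapping.single i n"
    by (simp only: single_add[symmetric] plus_1_eq_Suc)
  show ?case unfolding power_Suc Suc.IH e unfolding Var_def mult_single mult_1_left ..
qed simp

lemma monom_eval_Var: "monom_eval Var \<nu> = (Poly_Mapping.single \<nu> 1 :: ('n::finite, 'k::comm_ring_1) mpoly)"
proof -
  have "(\<Prod>i\<in>A. Poly_Mapping.single (Poly_Mapping.single i (Poly_Mapping.lookup \<nu> i)) 1) =
      (Poly_Mapping.single (\<Sum>i\<in>A. Poly_Mapping.single i (Poly_Mapping.lookup \<nu> i)) 1 :: ('n, 'k) mpoly)" for A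
    by (induction A rule: infinite_finite_induct) (simp_all add: mult_single)
  moreover have "(\<Sum>i\<in>UNIV. Poly_Mapping.single i (Poly_Mapping.lookup \<nu> i)) = \<nu>"
    by (rule poly_mapping_eqI) (simp add: lookup_sum lookup_single when_def)
  ultimately show ?thesis by (simp add: monom_eval_def Var_power)
qed

lemma lin_subst_mat_1: "lin_subst (mat 1) f = (f :: ('n::finite, 'k::comm_ring_1) mpoly)"
proof -
  have "linear_form (mat 1 :: 'k^'n^'n) i = Var i" for i
  proof -
    have "linear_form (mat 1 :: 'k^'n^'n) i = (\<Sum>j\<in>UNIV. if j = i then Var j else 0)"
      unfolding linear_form_def by (intro sum.cong) (auto simp: mat_def)
    then show ?thesis by simp
  qed
  then have "linear_form (mat 1 :: 'k^'n^'n) = Var" by (rule ext)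
  then have "subst.ev (mat 1) f = (\<Sum>\<nu>\<in>Poly_Mapping.keys f. Poly_Mapping.single \<nu> (Poly_Mapping.lookup f \<nu>))"
    unfolding subst.ev_def by (simp add: monom_eval_Var mult_single)
  then show ?thesis by (simp add: lin_subst_eq sum_singles)
qed

lemma lin_subst_inverse:
  assumes "invertible g"
  shows "\<exists>h. (\<forall>f. lin_subst g (lin_subst h f) = f) \<and> (\<forall>f. lin_subst h (lin_subst g f) = f)"
proof -
  obtain h where "g ** h = mat 1" "h ** g = mat 1" using assms unfolding invertible_def by blast
  then show ?thesis by (intro exI[of _ h]) (simp add: lin_subst_lin_subst lin_subst_mat_1)
qed

section \<open>Substitution preserves degrees, graded ideals and dimensions\<close>

lemma forms_sum: "(\<And>x. x \<in> A \<Longrightarrow> F x \<in> forms d) \<Longrightarrow> (\<Sum>x\<in>A. F x) \<in> forms d"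
  unfolding mem_forms lookup_sum by (meson sum.neutral)

lemma forms_mult: "f \<in> forms d \<Longrightarrow> g \<in> forms e \<Longrightarrow> f * g \<in> forms (d + e)"
proof -
  assume f: "f \<in> forms d" and g: "g \<in> forms e"
  show ?thesis
    unfolding mem_forms
  proof (intro allI impI)
    fix \<nu> assume "Poly_Mapping.lookup (f * g) \<nu> \<noteq> 0"
    then have "\<nu> \<in> Poly_Mapping.keys (f * g)" by (simp add: in_keys_iff)
    then obtain a b where "\<nu> = a + b" "a \<in> Poly_Mapping.keys f" "b \<in> Poly_Mapping.keys g"
      using keys_mult[of f g] by blast
    then show "total_deg \<nu> = d + e" using f g by (simp add: mem_forms in_keys_iff)
  qed
qed

lemma forms_1: "1 \<in> forms 0"
  by (simp add: mem_forms lookup_one when_def total_deg_def)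

lemma forms_const: "Poly_Mapping.single 0 a \<in> forms 0"
  by (simp add: mem_forms lookup_single when_def total_deg_def)

lemma forms_power: "f \<in> forms d \<Longrightarrow> f ^ n \<in> forms (n * d)"
  by (induction n) (simp_all add: forms_1 forms_mult)

lemma forms_prod: "(\<And>x. x \<in> A \<Longrightarrow> F x \<in> forms (d x)) \<Longrightarrow> (\<Prod>x\<in>A. F x) \<in> forms (\<Sum>x\<in>A. d x)"
  by (induction A rule: infinite_finite_induct) (simp_all add: forms_1 forms_mult)

lemma total_deg_single [simp]: "total_deg (Poly_Mapping.single i k) = k"
  by (simp add: total_deg_def lookup_single when_def)

lemma linear_form_forms: "linear_form g i \<in> forms 1"
proof -
  have "Var j \<in> forms 1" for j :: 'a
    by (auto simp: Var_def mem_forms lookup_single when_def split: if_splits)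
  then have "Poly_Mapping.single 0 (g $ i $ j) * Var j \<in> forms (0 + 1)" for j
    by (intro forms_mult forms_const)
  then show ?thesis unfolding linear_form_def by (intro forms_sum) simp
qed

lemma monom_eval_forms:
  assumes "\<And>i. \<phi> i \<in> forms 1"
  shows "monom_eval \<phi> \<nu> \<in> forms (total_deg \<nu>)"
proof -
  have "\<phi> i ^ Poly_Mapping.lookup \<nu> i \<in> forms (Poly_Mapping.lookup \<nu> i)" for i
    using forms_power[OF assms[of i], of "Poly_Mapping.lookup \<nu> i"] by simp
  then show ?thesis unfolding monom_eval_def total_deg_def by (intro forms_prod)
qed

lemma lin_subst_forms:
  assumes "f \<in> forms d"
  shows "lin_subst g f \<in> forms d"
  unfolding lin_subst_eq subst.ev_def
proof (rule forms_sum)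
  fix \<nu> assume "\<nu> \<in> Poly_Mapping.keys f"
  then have "total_deg \<nu> = d" using assms by (simp add: mem_forms in_keys_iff)
  moreover have "monom_eval (linear_form g) \<nu> \<in> forms (total_deg \<nu>)"
    by (rule monom_eval_forms) (rule linear_form_forms)
  ultimately have "Poly_Mapping.single 0 (Poly_Mapping.lookup f \<nu>) * monom_eval (linear_form g) \<nu> \<in> forms (0 + d)"
    by (intro forms_mult forms_const) simp
  then show "Poly_Mapping.single 0 (Poly_Mapping.lookup f \<nu>) * monom_eval (linear_form g) \<nu> \<in> forms d" by simp
qed

lemma lin_subst_add: "lin_subst g (a + b) = lin_subst g a + lin_subst g b"
  and lin_subst_mult: "lin_subst g (a * b) = lin_subst g a * lin_subst g b"
  and lin_subst_sum: "lin_subst g (sum F A) = (\<Sum>x\<in>A. lin_subst g (F x))"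
  and lin_subst_0: "lin_subst g 0 = 0"
  and lin_subst_const: "lin_subst g (Poly_Mapping.single 0 c) = Poly_Mapping.single 0 c"
  by (simp_all add: lin_subst_eq subst.ev_add subst.ev_mult subst.ev_sum subst.ev_const subst.ev_0)

lemma lin_subst_cmul: "lin_subst g (cmul c a) = cmul c (lin_subst g a)"
  by (simp add: cmul_def lin_subst_mult lin_subst_const)

lemma hom_comp_lin_subst: "hom_comp d (lin_subst g f) = lin_subst g (hom_comp d f)"
proof -
  let ?E = "total_deg ` Poly_Mapping.keys f"
  have hs: "hom_comp d (sum F A) = (\<Sum>x\<in>A. hom_comp d (F x))" for F :: "nat \<Rightarrow> ('a, 'b) mpoly" and A
    by (rule poly_mapping_eqI) (simp add: lookup_sum)
  have "hom_comp d (lin_subst g f) = (\<Sum>e\<in>?E. hom_comp d (lin_subst g (hom_comp e f)))"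
    by (subst (1) sum_hom_comp[of f]) (simp only: lin_subst_sum hs)
  also have "\<dots> = (\<Sum>e\<in>?E. if e = d then lin_subst g (hom_comp d f) else 0)"
    by (intro sum.cong) (auto simp: hom_comp_of_form[OF lin_subst_forms[OF hom_comp_forms]])
  also have "\<dots> = (if d \<in> ?E then lin_subst g (hom_comp d f) else 0)" by simp
  also have "\<dots> = lin_subst g (hom_comp d f)"
  proof -
    have "hom_comp d f = 0" if "d \<notin> ?E"
      using that by (intro poly_mapping_eqI) (auto simp: in_keys_iff image_iff)
    then show ?thesis by (simp add: lin_subst_0)
  qed
  finally show ?thesis .
qed

lemma graded_ideal_lin_subst:
  assumes I: "graded_ideal I" and g: "invertible g"
  shows "graded_ideal (lin_subst g ` I)"
  unfolding graded_ideal_def is_ideal_def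
proof (intro conjI ballI allI)
  note iI = graded_ideal_is_ideal[OF I]
  obtain h where h: "\<forall>f. lin_subst g (lin_subst h f) = f" using lin_subst_inverse[OF g] by blast
  show "0 \<in> lin_subst g ` I" using ideal_0[OF iI] lin_subst_0[of g] by force
  fix a assume "a \<in> lin_subst g ` I"
  then obtain a' where a: "a = lin_subst g a'" "a' \<in> I" by blast
  show "r * a \<in> lin_subst g ` I" for r
  proof -
    \<comment> \<open>An image of an ideal absorbs arbitrary factors because the substitution is
      surjective: \<open>r\<close> is the image of \<open>lin_subst h r\<close>.\<close>
    have "r * a = lin_subst g (lin_subst h r * a')" by (simp add: a lin_subst_mult h)
    then show ?thesis using ideal_mult[OF iI a(2)] by blast
  qed
  show "hom_comp d a \<in> lin_subst g ` I" for d
    using I a by (auto simp: hom_comp_lin_subst graded_ideal_def)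
  fix b assume "b \<in> lin_subst g ` I"
  then obtain b' where b: "b = lin_subst g b'" "b' \<in> I" by blast
  show "a + b \<in> lin_subst g ` I"
    using ideal_add[OF iI a(2) b(2)] by (auto simp: a b lin_subst_add[symmetric])
qed

lemma lin_subst_Int_forms:
  assumes "graded_ideal I"
  shows "lin_subst g ` I \<inter> forms d = lin_subst g ` (I \<inter> forms d)"
proof
  show "lin_subst g ` (I \<inter> forms d) \<subseteq> lin_subst g ` I \<inter> forms d" by (auto simp: lin_subst_forms)
  show "lin_subst g ` I \<inter> forms d \<subseteq> lin_subst g ` (I \<inter> forms d)"
  proof
    fix y assume "y \<in> lin_subst g ` I \<inter> forms d"
    then obtain f where f: "f \<in> I" "y = lin_subst g f" "y \<in> forms d" by blast
    have "y = lin_subst g (hom_comp d f)"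
      using hom_comp_of_form[OF f(3), of d] f(2) by (simp add: hom_comp_lin_subst)
    moreover have "hom_comp d f \<in> I \<inter> forms d" using assms f(1) by (simp add: graded_ideal_def)
    ultimately show "y \<in> lin_subst g ` (I \<inter> forms d)" by blast
  qed
qed

lemma dim_lin_subst:
  fixes V :: "('n::finite, 'k::field) mpoly set"
  assumes g: "invertible g"
  shows "mp.dim (lin_subst g ` V) = mp.dim V"
proof -
  have hom: "module_hom cmul cmul (lin_subst g :: ('n, 'k) mpoly \<Rightarrow> _)"
    unfolding module_hom_def module_hom_axioms_def
    using mp.module_axioms lin_subst_add[of g] lin_subst_cmul[of g] by blast
  obtain h where h: "\<forall>f. lin_subst h (lin_subst g f) = f" using lin_subst_inverse[OF g] by blast
  have inj: "inj_on (lin_subst g) A" for A :: "('n, 'k) mpoly set"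
    by (rule inj_on_inverseI[of _ "lin_subst h"]) (simp add: h)
  obtain B where B: "B \<subseteq> V" "mp.independent B" "V \<subseteq> mp.span B" "card B = mp.dim V"
    by (rule mp.basis_exists)
  have "card (lin_subst g ` B) = mp.dim (lin_subst g ` V)"
  proof (rule mp.basis_card_eq_dim)
    show "lin_subst g ` B \<subseteq> lin_subst g ` V" using B(1) by (rule image_mono)
    show "lin_subst g ` V \<subseteq> mp.span (lin_subst g ` B)" using B(3) by (rule module_hom.spans_image[OF hom])
    show "mp.independent (lin_subst g ` B)" using B(2) inj by (rule module_hom.independent_injective_image[OF hom])
  qed
  then show ?thesis using B(4) by (simp add: card_image[OF inj])
qed

subsection \<open>Genericity\<close>

text \<open>Regular functions on matrix space, kept as functions so that closure properties apply
  without naming representing polynomials.\<close>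

definition polyfun :: "('k::comm_ring_1^'n::finite^'n \<Rightarrow> 'k) \<Rightarrow> bool" where
  "polyfun F \<longleftrightarrow> (\<exists>p. F = mpeval p)"

lemma polyfun_const: "polyfun (\<lambda>_. a)"
  unfolding polyfun_def by (intro exI[of _ "Poly_Mapping.single 0 a"] ext) (simp add: mpeval_eq entries.ev_const)

lemma polyfun_entry: "polyfun (\<lambda>g. g $ i $ j)"
  unfolding polyfun_def by (intro exI[of _ "Var (i, j)"] ext) (simp add: mpeval_eq entries.ev_Var)

lemma polyfun_add: "polyfun F \<Longrightarrow> polyfun G \<Longrightarrow> polyfun (\<lambda>g. F g + G g)"
proof -
  assume "polyfun F" "polyfun G"
  then obtain p q where pq: "F = mpeval p" "G = mpeval q" unfolding polyfun_def by blast
  show ?thesis unfolding polyfun_def pq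
    by (intro exI[of _ "p + q"] ext) (simp add: mpeval_eq entries.ev_add)
qed

lemma polyfun_mult: "polyfun F \<Longrightarrow> polyfun G \<Longrightarrow> polyfun (\<lambda>g. F g * G g)"
proof -
  assume "polyfun F" "polyfun G"
  then obtain p q where pq: "F = mpeval p" "G = mpeval q" unfolding polyfun_def by blast
  show ?thesis unfolding polyfun_def pq
    by (intro exI[of _ "p * q"] ext) (simp add: mpeval_eq entries.ev_mult)
qed

lemma polyfun_uminus: "polyfun F \<Longrightarrow> polyfun (\<lambda>g. - F g)"
  using polyfun_mult[OF polyfun_const[of "-1"], of F] by simp

lemma polyfun_sum: "(\<And>x. x \<in> A \<Longrightarrow> polyfun (F x)) \<Longrightarrow> polyfun (\<lambda>g. \<Sum>x\<in>A. F x g)"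
  by (induction A rule: infinite_finite_induct) (simp_all add: polyfun_const polyfun_add)

lemma polyfun_prod: "(\<And>x. x \<in> A \<Longrightarrow> polyfun (F x)) \<Longrightarrow> polyfun (\<lambda>g. \<Prod>x\<in>A. F x g)"
  by (induction A rule: infinite_finite_induct) (simp_all add: polyfun_const polyfun_mult)

lemma polyfun_det: "polyfun (det :: 'k::comm_ring_1^'n::finite^'n \<Rightarrow> 'k)"
  unfolding det_def by (intro polyfun_sum polyfun_mult polyfun_const polyfun_prod polyfun_entry)

lemma polyfun_on_line:
  fixes F :: "'k::field^'n::finite^'n \<Rightarrow> 'k"
  assumes "polyfun F"
  shows "\<exists>p. \<forall>t. poly p t = F (\<chi> i j. a $ i $ j + t * (b $ i $ j - a $ i $ j))"
proof -
  obtain q where q: "F = mpeval q" using assms unfolding polyfun_def by blast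
  let ?p = "\<Sum>\<nu>\<in>Poly_Mapping.keys q. [:Poly_Mapping.lookup q \<nu>:] *
      (\<Prod>ij\<in>UNIV. [:a $ fst ij $ snd ij, b $ fst ij $ snd ij - a $ fst ij $ snd ij:] ^ Poly_Mapping.lookup \<nu> ij)"
  have "poly ?p t = F (\<chi> i j. a $ i $ j + t * (b $ i $ j - a $ i $ j))" for t
    unfolding q mpeval_def by (simp add: poly_sum poly_prod poly_power)
  then show ?thesis by blast
qed

text \<open>Restrict to the line through two points where the functions do not vanish.\<close>
lemma polyfun_mult_nonzero:
  fixes F G :: "'k::field_char_0^'n::finite^'n \<Rightarrow> 'k"
  assumes F: "polyfun F" "F a \<noteq> 0" and G: "polyfun G" "G b \<noteq> 0"
  shows "\<exists>g. F g * G g \<noteq> 0"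
proof -
  define L where "L t = (\<chi> i j. a $ i $ j + t * (b $ i $ j - a $ i $ j))" for t
  have "L 0 = a" "L 1 = b" by (simp_all add: L_def vec_eq_iff)
  obtain p where p: "\<And>t. poly p t = F (L t)" using polyfun_on_line[OF F(1), of a b] unfolding L_def by blast
  obtain q where q: "\<And>t. poly q t = G (L t)" using polyfun_on_line[OF G(1), of a b] unfolding L_def by blast
  have "p \<noteq> 0" using p[of 0] F(2) \<open>L 0 = a\<close> by auto
  moreover have "q \<noteq> 0" using q[of 1] G(2) \<open>L 1 = b\<close> by auto
  ultimately have "p * q \<noteq> 0" by simp
  then have "finite {t. poly (p * q) t = 0}" by (rule poly_roots_finite)
  with infinite_UNIV_char_0[where 'a = 'k] have "{t. poly (p * q) t = 0} \<noteq> UNIV"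
    by (intro notI) (simp only:)
  then obtain t where "poly (p * q) t \<noteq> 0" by blast
  then have "F (L t) * G (L t) \<noteq> 0" by (simp add: p q)
  then show ?thesis by blast
qed

lemma polyfun_prod_nonzero:
  fixes F :: "'i \<Rightarrow> 'k::field_char_0^'n::finite^'n \<Rightarrow> 'k"
  assumes "finite A" "\<And>x. x \<in> A \<Longrightarrow> polyfun (F x)" "\<And>x. x \<in> A \<Longrightarrow> \<exists>g. F x g \<noteq> 0"
  shows "\<exists>g. (\<Prod>x\<in>A. F x g) \<noteq> 0"
  using assms
proof (induction A rule: finite_induct)
  case (insert x A)
  obtain a where a: "F x a \<noteq> 0" using insert.prems(2)[of x] by blast
  obtain b where b: "(\<Prod>x\<in>A. F x b) \<noteq> 0" using insert.IH insert.prems by blast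
  have "polyfun (F x)" "polyfun (\<lambda>g. \<Prod>x\<in>A. F x g)"
    using insert.prems(1) by (blast intro: polyfun_prod)+
  from polyfun_mult_nonzero[OF this(1) a this(2) b] show ?case using insert.hyps by simp
qed simp

text \<open>Polynomials whose coefficients are polynomial functions of the matrix. The support bound
  common to all \<open>g\<close> turns a coefficient of a product into a fixed finite sum, see
  \<open>lookup_mult_superset\<close>.\<close>

definition polyfam :: "('k::comm_ring_1^'n::finite^'n \<Rightarrow> ('n, 'k) mpoly) \<Rightarrow> bool" where
  "polyfam F \<longleftrightarrow> (\<exists>T. finite T \<and> (\<forall>g. Poly_Mapping.keys (F g) \<subseteq> T)) \<and>
     (\<forall>\<nu>. polyfun (\<lambda>g. Poly_Mapping.lookup (F g) \<nu>))"

lemma polyfam_lookup: "polyfam F \<Longrightarrow> polyfun (\<lambda>g. Poly_Mapping.lookup (F g) \<nu>)"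
  by (simp add: polyfam_def)

lemma polyfam_add:
  assumes "polyfam F" "polyfam G"
  shows "polyfam (\<lambda>g. F g + G g)"
proof -
  obtain T U where T: "finite T" "\<And>g. Poly_Mapping.keys (F g) \<subseteq> T"
    and U: "finite U" "\<And>g. Poly_Mapping.keys (G g) \<subseteq> U"
    using assms unfolding polyfam_def by blast
  have "Poly_Mapping.keys (F g + G g) \<subseteq> T \<union> U" for g
    using keys_add[of "F g" "G g"] T(2)[of g] U(2)[of g] by blast
  then have "\<exists>T. finite T \<and> (\<forall>g. Poly_Mapping.keys (F g + G g) \<subseteq> T)"
    using T(1) U(1) by (intro exI[of _ "T \<union> U"]) simp
  then show ?thesis
    unfolding polyfam_def lookup_add by (intro conjI allI polyfun_add polyfam_lookup assms)
qed

lemma lookup_mult_superset: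
  assumes "finite T" "Poly_Mapping.keys f \<subseteq> T" "finite U" "Poly_Mapping.keys g \<subseteq> U"
  shows "Poly_Mapping.lookup (f * g) \<xi> =
    (\<Sum>\<nu>\<in>T. \<Sum>\<mu>\<in>U. if \<nu> + \<mu> = \<xi> then Poly_Mapping.lookup f \<nu> * Poly_Mapping.lookup g \<mu> else 0)"
proof -
  have sup: "h = (\<Sum>\<nu>\<in>A. Poly_Mapping.single \<nu> (Poly_Mapping.lookup h \<nu>))"
    if "finite A" "Poly_Mapping.keys h \<subseteq> A" for A and h :: "'a \<Rightarrow>\<^sub>0 'b"
  proof -
    have "(\<Sum>\<nu>\<in>A. Poly_Mapping.single \<nu> (Poly_Mapping.lookup h \<nu>)) =
        (\<Sum>\<nu>\<in>Poly_Mapping.keys h. Poly_Mapping.single \<nu> (Poly_Mapping.lookup h \<nu>))"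
      using that by (intro sum.mono_neutral_right) (auto simp: in_keys_iff)
    then show ?thesis using sum_singles[of h] by simp
  qed
  have "f * g = (\<Sum>\<nu>\<in>T. Poly_Mapping.single \<nu> (Poly_Mapping.lookup f \<nu>)) * (\<Sum>\<mu>\<in>U. Poly_Mapping.single \<mu> (Poly_Mapping.lookup g \<mu>))"
    using sup[OF assms(1,2)] sup[OF assms(3,4)] by simp
  also have "\<dots> = (\<Sum>\<nu>\<in>T. \<Sum>\<mu>\<in>U. Poly_Mapping.single (\<nu> + \<mu>) (Poly_Mapping.lookup f \<nu> * Poly_Mapping.lookup g \<mu>))"
    by (simp add: sum_product mult_single)
  finally show ?thesis by (simp add: lookup_sum lookup_single when_def)
qed

lemma polyfam_mult:
  assumes "polyfam F" "polyfam G"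
  shows "polyfam (\<lambda>g. F g * G g)"
proof -
  obtain T U where T: "finite T" "\<And>g. Poly_Mapping.keys (F g) \<subseteq> T"
    and U: "finite U" "\<And>g. Poly_Mapping.keys (G g) \<subseteq> U"
    using assms unfolding polyfam_def by blast
  let ?W = "(\<lambda>(a, b). a + b) ` (T \<times> U)"
  have "Poly_Mapping.keys (F g * G g) \<subseteq> ?W" for g
  proof
    fix \<nu> assume "\<nu> \<in> Poly_Mapping.keys (F g * G g)"
    then obtain a b where "\<nu> = a + b" "a \<in> Poly_Mapping.keys (F g)" "b \<in> Poly_Mapping.keys (G g)"
      using keys_mult[of "F g" "G g"] by blast
    then show "\<nu> \<in> ?W" using T(2) U(2) by (intro image_eqI[of _ _ "(a, b)"]) auto
  qed
  then have "\<exists>T. finite T \<and> (\<forall>g. Poly_Mapping.keys (F g * G g) \<subseteq> T)"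
    using T(1) U(1) by (intro exI[of _ ?W]) simp
  moreover have "polyfun (\<lambda>g. Poly_Mapping.lookup (F g * G g) \<xi>)" for \<xi>
  proof -
    have *: "polyfun (\<lambda>g. if \<nu> + \<mu> = \<xi> then Poly_Mapping.lookup (F g) \<nu> * Poly_Mapping.lookup (G g) \<mu> else 0)" for \<nu> \<mu>
      using assms by (cases "\<nu> + \<mu> = \<xi>") (simp_all add: polyfun_const polyfun_mult polyfam_lookup)
    show ?thesis
      unfolding lookup_mult_superset[OF T(1) T(2) U(1) U(2)] by (intro polyfun_sum *)
  qed
  ultimately show ?thesis unfolding polyfam_def by blast
qed

lemma polyfam_single:
  assumes "polyfun c"
  shows "polyfam (\<lambda>g. Poly_Mapping.single \<nu> (c g))"
proof -
  have "polyfun (\<lambda>g. Poly_Mapping.lookup (Poly_Mapping.single \<nu> (c g)) \<mu>)" for \<mu>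
    using assms by (cases "\<nu> = \<mu>") (simp_all add: lookup_single polyfun_const)
  moreover have "\<exists>T. finite T \<and> (\<forall>g. Poly_Mapping.keys (Poly_Mapping.single \<nu> (c g)) \<subseteq> T)"
    by (intro exI[of _ "{\<nu>}"]) simp
  ultimately show ?thesis unfolding polyfam_def by blast
qed

lemma polyfam_0: "polyfam (\<lambda>_. 0)"
  using polyfam_single[OF polyfun_const[of 0], of 0] by simp

lemma polyfam_sum: "(\<And>x. x \<in> A \<Longrightarrow> polyfam (F x)) \<Longrightarrow> polyfam (\<lambda>g. \<Sum>x\<in>A. F x g)"
  by (induction A rule: infinite_finite_induct) (simp_all add: polyfam_add polyfam_0)

lemma polyfam_1: "polyfam (\<lambda>_. 1)"
  using polyfam_single[OF polyfun_const[of 1], of 0] by simp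

lemma polyfam_prod: "(\<And>x. x \<in> A \<Longrightarrow> polyfam (F x)) \<Longrightarrow> polyfam (\<lambda>g. \<Prod>x\<in>A. F x g)"
  by (induction A rule: infinite_finite_induct) (simp_all add: polyfam_mult polyfam_1)

lemma polyfam_power: "polyfam F \<Longrightarrow> polyfam (\<lambda>g. F g ^ n)"
  by (induction n) (simp_all add: polyfam_mult polyfam_1)

lemma polyfam_lin_subst: "polyfam (\<lambda>g. lin_subst g f)"
  unfolding lin_subst_def Var_def
  by (intro polyfam_sum polyfam_mult polyfam_single polyfun_const polyfam_prod polyfam_power polyfun_entry)

lemma polyfam_cmul: "polyfun c \<Longrightarrow> polyfam F \<Longrightarrow> polyfam (\<lambda>g. cmul (c g) (F g))"
  unfolding cmul_def by (intro polyfam_mult polyfam_single)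

text \<open>Fraction-free Gaussian elimination over the ring of polynomial functions.\<close>
lemma dual_family_open:
  fixes \<F> :: "('k::field^'n::finite^'n \<Rightarrow> ('n, 'k) mpoly) set"
  assumes add: "\<And>F G. F \<in> \<F> \<Longrightarrow> G \<in> \<F> \<Longrightarrow> (\<lambda>g. F g + G g) \<in> \<F>"
    and scale: "\<And>c F. polyfun c \<Longrightarrow> F \<in> \<F> \<Longrightarrow> (\<lambda>g. cmul (c g) (F g)) \<in> \<F>"
    and coeff: "\<And>F \<nu>. F \<in> \<F> \<Longrightarrow> polyfun (\<lambda>g. Poly_Mapping.lookup (F g) \<nu>)"
    and S: "finite S"
    and dual: "\<And>s. s \<in> S \<Longrightarrow> \<exists>F\<in>\<F>. \<forall>t\<in>S. Poly_Mapping.lookup (F g0) t = (if t = s then 1 else 0)"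
  shows "\<exists>P. polyfun P \<and> P g0 \<noteq> 0 \<and>
    (\<forall>s\<in>S. \<exists>F\<in>\<F>. \<forall>g. \<forall>t\<in>S. Poly_Mapping.lookup (F g) t = (if t = s then P g else 0))"
  using S dual
proof (induction S rule: finite_induct)
  case empty
  show ?case by (intro exI[of _ "\<lambda>_. 1"]) (simp add: polyfun_const)
next
  case (insert x S)
  let ?l = Poly_Mapping.lookup
  have "\<exists>F\<in>\<F>. \<forall>t\<in>S. ?l (F g0) t = (if t = s then 1 else 0)" if "s \<in> S" for s
    using insert.prems[of s] that by blast
  from insert.IH[OF this] obtain P where P: "polyfun P" "P g0 \<noteq> 0"
    and exC: "\<forall>s\<in>S. \<exists>F\<in>\<F>. \<forall>g. \<forall>t\<in>S. ?l (F g) t = (if t = s then P g else 0)"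
    by blast
  from bchoice[OF exC[unfolded Bex_def]] obtain C where
    C: "\<forall>s\<in>S. C s \<in> \<F> \<and> (\<forall>g. \<forall>t\<in>S. ?l (C s g) t = (if t = s then P g else 0))" by blast
  obtain F where F: "F \<in> \<F>" "\<forall>t\<in>insert x S. ?l (F g0) t = (if t = x then 1 else 0)"
    using insert.prems[of x] by blast
  \<comment> \<open>\<open>B\<close> clears the coordinates in \<open>S\<close> from a multiple of
    \<open>F\<close> by means of the families already found; the factor \<open>P g\<close> avoids
    division.\<close>
  define B where "B g = cmul (P g) (F g) + (\<Sum>u\<in>S. cmul (- ?l (F g) u) (C u g))" for g
  have "(\<lambda>g. cmul (P g) (F g) + (\<Sum>u\<in>S'. cmul (- ?l (F g) u) (C u g))) \<in> \<F>" if "S' \<subseteq> S" for S'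
    using finite_subset[OF that insert.hyps(1)] that
  proof (induction S' rule: finite_induct)
    case empty
    then show ?case using scale[OF P(1) F(1)] by simp
  next
    case (insert v S')
    have "(\<lambda>g. cmul (- ?l (F g) v) (C v g)) \<in> \<F>"
      using insert.prems C by (intro scale polyfun_uminus coeff F(1)) blast
    moreover have "(\<lambda>g. cmul (P g) (F g) + (\<Sum>u\<in>S'. cmul (- ?l (F g) u) (C u g))) \<in> \<F>"
      using insert.IH insert.prems by blast
    ultimately have "(\<lambda>g. cmul (- ?l (F g) v) (C v g) +
        (cmul (P g) (F g) + (\<Sum>u\<in>S'. cmul (- ?l (F g) u) (C u g)))) \<in> \<F>" by (rule add)
    then show ?case using insert.hyps by (simp add: add.left_commute)
  qed
  then have B: "B \<in> \<F>" unfolding B_def by blast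
  have BS: "?l (B g) t = 0" if t: "t \<in> S" for g t
  proof -
    have "(\<Sum>u\<in>S. - ?l (F g) u * ?l (C u g) t) = (\<Sum>u\<in>S. if u = t then - ?l (F g) t * P g else 0)"
      using C t by (intro sum.cong) auto
    also have "\<dots> = - ?l (F g) t * P g" using t insert.hyps(1) by simp
    finally show ?thesis unfolding B_def lookup_add lookup_sum lookup_cmul by (simp add: mult.commute)
  qed
  define Q where "Q g = ?l (B g) x" for g
  have Q: "polyfun Q" unfolding Q_def by (rule coeff[OF B])
  \<comment> \<open>At \<open>g0\<close> the family \<open>F\<close> already vanishes on
    \<open>S\<close>, so the new pivot value \<open>Q g0\<close> is just \<open>P g0\<close>, which
    is nonzero.\<close>
  have "(\<Sum>u\<in>S. - ?l (F g0) u * ?l (C u g0) x) = 0"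
    using F(2) insert.hyps(2) by (intro sum.neutral) auto
  then have "Q g0 = P g0" unfolding Q_def B_def lookup_add lookup_sum lookup_cmul using F(2) by simp
  then have nz: "P g0 * Q g0 \<noteq> 0" using P(2) by simp
  have "\<exists>G\<in>\<F>. \<forall>g. \<forall>t\<in>insert x S. ?l (G g) t = (if t = s then P g * Q g else 0)" if s: "s \<in> insert x S" for s
  proof (cases "s = x")
    case True
    have "(\<lambda>g. cmul (P g) (B g)) \<in> \<F>" by (rule scale[OF P(1) B])
    moreover have "?l (cmul (P g) (B g)) t = (if t = s then P g * Q g else 0)" if "t \<in> insert x S" for g t
      using that True BS insert.hyps(2) by (auto simp: Q_def)
    ultimately show ?thesis by (intro bexI[of _ "\<lambda>g. cmul (P g) (B g)"]) blast+
  next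
    case False
    then have sS: "s \<in> S" using s by blast
    \<comment> \<open>Cross-multiplication clears the coordinate \<open>x\<close> of
      \<open>C s\<close>; since \<open>B\<close> vanishes on \<open>S\<close>, the diagonal value
      there becomes the common \<open>P g * Q g\<close>.\<close>
    let ?G = "\<lambda>g. cmul (Q g) (C s g) + cmul (- ?l (C s g) x) (B g)"
    have Cs: "C s \<in> \<F>" "\<And>g t. t \<in> S \<Longrightarrow> ?l (C s g) t = (if t = s then P g else 0)" using C sS by blast+
    have "?G \<in> \<F>" by (intro add scale Q Cs(1) B polyfun_uminus coeff)
    moreover have "?l (?G g) t = (if t = s then P g * Q g else 0)" if "t \<in> insert x S" for g t
    proof (cases "t = x")
      case True
      then show ?thesis using False by (simp add: lookup_add lookup_minus Q_def)
    next
      case False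
      then have "t \<in> S" using that by blast
      then show ?thesis using BS Cs(2) by (simp add: lookup_add lookup_minus)
    qed
    ultimately show ?thesis by (intro bexI[of _ ?G]) blast+
  qed
  then show ?case using nz by (intro exI[of _ "\<lambda>g. P g * Q g"] conjI polyfun_mult P(1) Q ballI)
qed

section \<open>Pivot sets of a generically transformed ideal\<close>

lemma piv_exists:
  fixes J :: "('n::finite, 'k::field) mpoly set"
  assumes "is_ideal J"
  shows "\<exists>S. piv (J \<inter> forms d) S"
proof -
  obtain w :: "real^'n" where "inj (wdeg w :: ('n \<Rightarrow>\<^sub>0 nat) \<Rightarrow> real)" using generic_weight_exists by blast
  then interpret generic_weight w by unfold_locales
  show ?thesis using piv_leads_forms[OF assms, of d 0] by blast
qed

lemma piv_subset: "V \<subseteq> supported X \<Longrightarrow> piv V S \<Longrightarrow> S \<subseteq> X"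
proof
  fix s assume V: "V \<subseteq> supported X" and S: "piv V S" and s: "s \<in> S"
  have "dual V S s \<in> supported X" using dual_in[OF S s] V by blast
  moreover have "Poly_Mapping.lookup (dual V S s) s \<noteq> 0" using lookup_dual[OF S s s] by simp
  ultimately show "s \<in> X" by (simp add: supported_def)
qed

text \<open>Dual vectors at \<open>g0\<close> spread to families that are dual up to the factor
  \<open>P\<close>. Where \<open>P\<close> does not vanish, dividing by it gives dual vectors, and
  these suffice by \<open>piv_of_dim\<close> because the dimension does not change with
  \<open>g\<close>.\<close>

lemma piv_lin_subst_open:
  fixes I :: "('n::finite, 'k::field) mpoly set"
  assumes I: "graded_ideal I" and g0: "invertible g0" and S: "piv (lin_subst g0 ` I \<inter> forms d) S"
  shows "\<exists>P. polyfun P \<and> P g0 \<noteq> 0 \<and>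
    (\<forall>g. invertible g \<longrightarrow> P g \<noteq> 0 \<longrightarrow> piv (lin_subst g ` I \<inter> forms d) S)"
proof -
  have sub: "mp.subspace (lin_subst g ` I \<inter> forms d)" if "invertible g" for g
    by (intro subspace_form_part graded_ideal_is_ideal graded_ideal_lin_subst I that)
  have dim: "mp.dim (lin_subst g ` I \<inter> forms d) = mp.dim (I \<inter> forms d)" if "invertible g" for g
    unfolding lin_subst_Int_forms[OF I] by (rule dim_lin_subst[OF that])
  \<comment> \<open>Membership is demanded only at invertible \<open>g\<close>, where the degree
    \<open>d\<close> part of the image is known to be a subspace.\<close>
  define \<F> where "\<F> = {F. polyfam F \<and> (\<forall>g. invertible g \<longrightarrow> F g \<in> lin_subst g ` I \<inter> forms d)}"
  have "\<exists>P. polyfun P \<and> P g0 \<noteq> 0 \<and>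
    (\<forall>s\<in>S. \<exists>F\<in>\<F>. \<forall>g. \<forall>t\<in>S. Poly_Mapping.lookup (F g) t = (if t = s then P g else 0))"
  proof (rule dual_family_open[OF _ _ _ piv_finite[OF S]])
    fix F G :: "'k^'n^'n \<Rightarrow> ('n, 'k) mpoly" assume "F \<in> \<F>" "G \<in> \<F>"
    then show "(\<lambda>g. F g + G g) \<in> \<F>"
      by (simp add: \<F>_def polyfam_add mp.subspace_add[OF sub] del: Int_iff)
  next
    fix c F assume "polyfun (c :: 'k^'n^'n \<Rightarrow> 'k)" "F \<in> \<F>"
    then show "(\<lambda>g. cmul (c g) (F g)) \<in> \<F>"
      by (simp add: \<F>_def polyfam_cmul mp.subspace_scale[OF sub] del: Int_iff)
  next
    fix F \<nu> assume "F \<in> \<F>"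
    then show "polyfun (\<lambda>g. Poly_Mapping.lookup (F g) \<nu>)" by (simp add: \<F>_def polyfam_lookup)
  next
    fix s assume s: "s \<in> S"
    let ?f = "dual (lin_subst g0 ` I \<inter> forms d) S s"
    have "?f \<in> lin_subst g0 ` (I \<inter> forms d)" using dual_in[OF S s] unfolding lin_subst_Int_forms[OF I] .
    then obtain f where f: "f \<in> I \<inter> forms d" "?f = lin_subst g0 f" by blast
    \<comment> \<open>A vector dual at \<open>g0\<close> extends to all \<open>g\<close> by
      transporting its preimage \<open>f\<close> in \<open>I\<close>.\<close>
    have "(\<lambda>g. lin_subst g f) \<in> \<F>"
      unfolding \<F>_def lin_subst_Int_forms[OF I] using f(1) polyfam_lin_subst[of f] by blast
    moreover have "\<forall>t\<in>S. Poly_Mapping.lookup (lin_subst g0 f) t = (if t = s then 1 else 0)"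
      unfolding f(2)[symmetric] using lookup_dual[OF S s] by blast
    ultimately show "\<exists>F\<in>\<F>. \<forall>t\<in>S. Poly_Mapping.lookup (F g0) t = (if t = s then 1 else 0)"
      by (intro bexI[of _ "\<lambda>g. lin_subst g f"])
  qed
  then obtain P where P: "polyfun P" "P g0 \<noteq> 0"
    and dual: "\<And>s. s \<in> S \<Longrightarrow> \<exists>F\<in>\<F>. \<forall>g. \<forall>t\<in>S. Poly_Mapping.lookup (F g) t = (if t = s then P g else 0)"
    by blast
  have "piv (lin_subst g ` I \<inter> forms d) S" if g: "invertible g" "P g \<noteq> 0" for g
  proof -
    obtain S0 where S0: "piv (lin_subst g ` I \<inter> forms d) S0"
      using piv_exists[OF graded_ideal_is_ideal[OF graded_ideal_lin_subst[OF I g(1)]]] by blast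
    show ?thesis
    proof (rule piv_of_dim[OF sub[OF g(1)] S0 piv_finite[OF S]])
      show "card S = mp.dim (lin_subst g ` I \<inter> forms d)"
        using piv_dim[OF sub[OF g0] S] dim[OF g0] dim[OF g(1)] by simp
      fix s assume "s \<in> S"
      then obtain F where F: "F \<in> \<F>" "\<And>t. t \<in> S \<Longrightarrow> Poly_Mapping.lookup (F g) t = (if t = s then P g else 0)"
        using dual by blast
      have "cmul (inverse (P g)) (F g) \<in> lin_subst g ` I \<inter> forms d"
        using F(1) g(1) by (intro mp.subspace_scale sub) (simp_all add: \<F>_def)
      moreover have "\<forall>t\<in>S. Poly_Mapping.lookup (cmul (inverse (P g)) (F g)) t = (if t = s then 1 else 0)"
        using F(2) g(2) by simp
      ultimately show "\<exists>f\<in>lin_subst g ` I \<inter> forms d. \<forall>t\<in>S. Poly_Mapping.lookup f t = (if t = s then 1 else 0)"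
        by blast
    qed
  qed
  then show ?thesis using P by blast
qed

theorem theorem6p8:
  fixes I :: "('n::finite, 'k::field_char_0) mpoly set"
  assumes "alg_closed TYPE('k)"
    and "graded_ideal I"
    and "is_prime_ideal I"
    and "krull_dim I > 0"
  shows "\<exists>U :: ('k^'n^'n) set. zariski_open_GL U \<and> U \<noteq> {} \<and>
           (\<forall>g\<in>U. \<forall>h\<in>U. trop_fan (lin_subst g ` I) = trop_fan (lin_subst h ` I))"
proof -
  note I = assms(2)
  let ?r = "\<lambda>d. mp.dim (I \<inter> forms d)"
  obtain D where D: "\<And>(J :: ('n, 'k) mpoly set) (K :: ('n, 'k) mpoly set). graded_ideal J \<Longrightarrow> graded_ideal K \<Longrightarrow>
      (\<And>d. mp.dim (J \<inter> forms d) = ?r d) \<Longrightarrow> (\<And>d. mp.dim (K \<inter> forms d) = ?r d) \<Longrightarrow>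
      (\<And>d S. d \<le> D \<Longrightarrow> piv (J \<inter> forms d) S \<longleftrightarrow> piv (K \<inter> forms d) S) \<Longrightarrow> trop_fan J = trop_fan K"
    using trop_fan_cong[of ?r] by blast
  define pv where "pv g d S \<longleftrightarrow> piv (lin_subst g ` I \<inter> forms d) S" for g :: "'k^'n^'n" and d S
  \<comment> \<open>The pivot sets, up to degree \<open>D\<close>, that occur for at least one
    invertible matrix. Each is a pivot set on an open set, and \<open>?U\<close> is cut out so that
    all of them are pivot sets simultaneously.\<close>
  define A where "A = {x. fst x \<le> D \<and> (\<exists>g. invertible g \<and> pv g (fst x) (snd x))}"
  have mons: "S \<subseteq> mons d" if "pv g d S" for g d S
    using that piv_subset[OF Int_lower2] unfolding pv_def by blast
  have "A \<subseteq> {..D} \<times> Pow (\<Union>d\<le>D. mons d)"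
  proof
    fix x assume "x \<in> A"
    then obtain g where "fst x \<le> D" "pv g (fst x) (snd x)" unfolding A_def by blast
    moreover from this have "snd x \<subseteq> mons (fst x)" using mons by blast
    ultimately show "x \<in> {..D} \<times> Pow (\<Union>d\<le>D. mons d)" by (auto simp: mem_Times_iff)
  qed
  then have finA: "finite A" by (rule finite_subset) simp
  have "\<exists>P. polyfun P \<and> (\<exists>g. P g * det g \<noteq> 0) \<and>
      (\<forall>g. invertible g \<longrightarrow> P g \<noteq> 0 \<longrightarrow> pv g (fst x) (snd x))" if x: "x \<in> A" for x
  proof -
    obtain g where g: "invertible g" "pv g (fst x) (snd x)" using x unfolding A_def by blast
    obtain P where P: "polyfun P" "P g \<noteq> 0"
        "\<forall>g. invertible g \<longrightarrow> P g \<noteq> 0 \<longrightarrow> pv g (fst x) (snd x)"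
      using piv_lin_subst_open[OF I g(1), of "fst x" "snd x"] g(2) unfolding pv_def by blast
    have "\<exists>g. P g * det g \<noteq> 0" using P(2) g(1) by (intro exI[of _ g]) (simp add: invertible_det_nz)
    then show ?thesis using P by blast
  qed
  then have "\<forall>x\<in>A. \<exists>P. polyfun P \<and> (\<exists>g. P g * det g \<noteq> 0) \<and>
      (\<forall>g. invertible g \<longrightarrow> P g \<noteq> 0 \<longrightarrow> pv g (fst x) (snd x))" ..
  from bchoice[OF this] obtain P where P_all: "\<forall>x\<in>A. polyfun (P x) \<and> (\<exists>g. P x g * det g \<noteq> 0) \<and>
      (\<forall>g. invertible g \<longrightarrow> P x g \<noteq> 0 \<longrightarrow> pv g (fst x) (snd x))" ..
  have P: "polyfun (P x)" "\<exists>g. P x g * det g \<noteq> 0"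
    "invertible g \<Longrightarrow> P x g \<noteq> 0 \<Longrightarrow> pv g (fst x) (snd x)" if "x \<in> A" for x g
    using bspec[OF P_all that] by simp_all
  have "polyfun (\<lambda>g. \<Prod>x\<in>A. P x g)" using P(1) by (rule polyfun_prod)
  then obtain p where p: "(\<lambda>g. \<Prod>x\<in>A. P x g) = mpeval p" unfolding polyfun_def by blast
  let ?U = "{g. invertible g \<and> (\<exists>q\<in>{p}. mpeval q g \<noteq> 0)}"
  have "zariski_open_GL ?U" unfolding zariski_open_GL_def by blast
  moreover have "?U \<noteq> {}"
  proof -
    have "\<exists>b. (\<Prod>x\<in>A. P x b) \<noteq> 0"
    proof (rule polyfun_prod_nonzero[OF finA P(1)])
      fix x assume "x \<in> A"
      then obtain g where "P x g * det g \<noteq> 0" using P(2) by blast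
      then show "\<exists>g. P x g \<noteq> 0" by (intro exI[of _ g]) simp
    qed
    then obtain b where b: "(\<Prod>x\<in>A. P x b) \<noteq> 0" by blast
    \<comment> \<open>The determinant enters as one more factor, so that the common point of
      nonvanishing is an invertible matrix.\<close>
    have "det (mat 1 :: 'k^'n^'n) \<noteq> 0" by simp
    from polyfun_mult_nonzero[OF polyfun_prod[OF P(1)] b polyfun_det this]
    obtain g where "(\<Prod>x\<in>A. P x g) \<noteq> 0" "det g \<noteq> 0" by auto
    then have "g \<in> ?U" using fun_cong[OF p, of g] by (simp add: invertible_det_nz)
    then show ?thesis by blast
  qed
  moreover have "trop_fan (lin_subst g ` I) = trop_fan (lin_subst h ` I)" if g: "g \<in> ?U" and h: "h \<in> ?U" for g h
  proof (rule D)
    \<comment> \<open>On \<open>?U\<close> nothing outside \<open>A\<close> can be a pivot set, by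
      the choice of \<open>A\<close>, and everything in \<open>A\<close> is one, since no factor of
      the product vanishes. The family is thus the same for \<open>g\<close> and
      \<open>h\<close>.\<close>
    have U_iff: "pv g d S \<longleftrightarrow> (d, S) \<in> A" if "d \<le> D" "g \<in> ?U" for g d S
    proof
      assume "pv g d S"
      then show "(d, S) \<in> A" using that unfolding A_def by auto
    next
      assume dS: "(d, S) \<in> A"
      have "(\<Prod>x\<in>A. P x g) \<noteq> 0" using that(2) fun_cong[OF p, of g] by simp
      then have "P (d, S) g \<noteq> 0" using dS finA by (auto simp del: split_paired_All)
      then show "pv g d S" using P(3)[OF dS] that(2) by simp
    qed
    have inv: "invertible g" "invertible h" using g h by simp_all
    show "graded_ideal (lin_subst g ` I)" "graded_ideal (lin_subst h ` I)"
      by (intro graded_ideal_lin_subst I inv)+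
    show "mp.dim (lin_subst g ` I \<inter> forms d) = ?r d" "mp.dim (lin_subst h ` I \<inter> forms d) = ?r d" for d
      unfolding lin_subst_Int_forms[OF I] by (intro dim_lin_subst inv)+
    show "piv (lin_subst g ` I \<inter> forms d) S \<longleftrightarrow> piv (lin_subst h ` I \<inter> forms d) S" if "d \<le> D" for d S
      using U_iff[OF that g] U_iff[OF that h] unfolding pv_def by simp
  qed
  ultimately show ?thesis by (intro exI[of _ ?U]) blast
qed

end
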